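(* Let $R$ be a commutative ring with unity. For every object $(A,\alpha)$ of $\operatorname{End}(\mathrm{FRel}(R))$, the objects $(A,\alpha)$ and $L(A,\alpha)$ are isomorphic in the Szymczak category $\operatorname{Szym}(\mathrm{FRel}(R))$, where $L$ is the Leray functor.
   Context: Linear relations. For $R$-modules $M,N$, a linear relation $\varphi\colon M\multimap N$ is a submodule $\varphi\subseteq M\oplus N$. For $\varphi\colon M\multimap N$ and $\psi\colon N\multimap P$, $\psi\circ\varphi=\{(m,p)\in M\oplus P:\exists n\in N,\ (m,n)\in\varphi,\ (n,p)\in\psi\}$, and $\varphi^{-1}=\{(n,m):(m,n)\in\varphi\}\colon N\multimap M$. For a subset $S\subseteq M$, $\varphi(S)=\{n\in N:\exists m\in S,\ (m,n)\in\varphi\}$, and $\varphi(0)=\varphi(\{0\})$. For $\alpha\colon A\multimap A$, $\alpha^0=\operatorname{id}_A$, $\alpha^k$ is the $k$-fold composition and $\alpha^{-k}=(\alpha^{-1})^k$ for $k\in\mathbb N$ ($0\in\mathbb{N}$). Module homomorphisms are identified with their graphs. Categories. $\mathrm{Rel}(R)$ has $R$-modules as objects and linear relations as morphisms, with the composition of $\varphi\colon M\multimap N$ and $\psi\colon N\multimap P$ given by $\psi\circ\varphi=\{(m,p)\in M\oplus P:\exists n\in N,\ (m,n)\in\varphi,\ (n,p)\in\psi\}$; $\mathrm{FRel}(R)$ is its full subcategory on the $R$-modules of finite length (both Noetherian and Artinian). For a category $\mathcal C$, $\operatorname{End}(\mathcal C)$ has as objects pairs $(A,\alpha)$ with $A\in\mathcal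 C$ and $\alpha\colon A\to A$ a morphism of $\mathcal C$; morphisms $(A,\alpha)\to(B,\beta)$ are morphisms $\varphi\colon A\to B$ of $\mathcal C$ with $\varphi\circ\alpha=\beta\circ\varphi$. The Szymczak category $\operatorname{Szym}(\mathcal C)$ has the same objects as $\operatorname{End}(\mathcal C)$; its morphisms $(A,\alpha)\to(B,\beta)$ are equivalence classes $[\varphi,n]$ of pairs $(\varphi,n)$, with $\varphi\colon(A,\alpha)\to(B,\beta)$ a morphism of $\operatorname{End}(\mathcal C)$ and $n\in\mathbb N$, under $(\varphi,n)\equiv(\psi,m)\iff\exists k\in\mathbb N:\ \varphi\circ\alpha^{m+k}=\psi\circ\alpha^{n+k}$. Composition is $[\psi,m]\circ[\varphi,n]=[\psi\circ\varphi,m+n]$, and the identity of $(A,\alpha)$ is $[\operatorname{id}_A,0]$. Leray functor. For a linear relation $\alpha\colon A\multimap A$, $\operatorname{gker}\alpha$ is the submodule of $A$ generated by $\bigcup_{l\in\mathbb Z}\alpha^l(0)$, and $\operatorname{gim}\alpha=\bigcap_{l\in\mathbb Z}\alpha^l(A)$. Let $\iota_A\colon\operatorname{gim}\alpha\to A$ be the inclusion and $\pi_A\colon A\to A/\operatorname{gker}\alpha$ the canonical projection. Put $\operatorname{LE}(A,\alpha)=(\operatorname{gim}\alpha,\ \iota_A^{-1}\circ\alpha\circ\iota_A)$, $\operatorname{LM}(A,\alpha)=(A/\operatorname{gker}\alpha,\ \pi_A\circ\alpha\circ\pi_A^{-1})$, and for a morphism $\varphi\colon(A,\alpha)\multimap(B,\beta)$,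 $\operatorname{LE}(\varphi)=\iota_B^{-1}\circ\varphi\circ\iota_A$, $\operatorname{LM}(\varphi)=\pi_B\circ\varphi\circ\pi_A^{-1}$. The Leray functor is $L=\operatorname{LE}\circ\operatorname{LM}$ (first apply $\operatorname{LM}$, then $\operatorname{LE}$). Since finite length passes to submodules and quotients, $L$ restricts to $\operatorname{End}(\mathrm{FRel}(R))$. *)

theory Defs
  imports "HOL-Algebra.Module" "HOL-Algebra.QuotRing" "HOL-Algebra.Chinese_Remainder"
begin

text \<open>Conventions. Modules are those of \<^theory>\<open>HOL-Algebra.Module\<close>, over a commutative ring
  with unity. The ring-multiplication fields \<open>mult\<close> and \<open>one\<close> of a module record play no
  role. The composite \<open>\<psi> \<circ> \<phi>\<close> of relations (first \<open>\<phi>\<close>, then \<open>\<psi>\<close>) is written \<open>\<phi> O \<psi>\<close>,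
  and \<open>\<phi>(S)\<close> is written \<open>\<phi> `` S\<close>. Objects of one category may have carriers in different
  HOL types, so the categorical notions are polymorphic constants.\<close>

section \<open>Modules\<close>

definition module_sum ::
    "('r, 'a, 'm) module_scheme \<Rightarrow> ('r, 'b, 'n) module_scheme \<Rightarrow> ('r, 'a \<times> 'b) module"
  where "module_sum M N =
    ring.extend (RDirProd M N) (module.fields (\<lambda>r (x, y). (r \<odot>\<^bsub>M\<^esub> x, r \<odot>\<^bsub>N\<^esub> y)))"

definition quotient_module ::
    "('r, 'a, 'm) module_scheme \<Rightarrow> 'a set \<Rightarrow> ('r, 'a set) module"
  where "quotient_module M H =
    ring.extend (M Quot H) (module.fields (\<lambda>r X. \<Union>x\<in>X. H +>\<^bsub>M\<^esub> (r \<odot>\<^bsub>M\<^esub> x)))"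

definition generated_submodule ::
    "('r, 's) ring_scheme \<Rightarrow> ('r, 'a, 'm) module_scheme \<Rightarrow> 'a set \<Rightarrow> 'a set"
  where "generated_submodule R M S = \<Inter>{H. submodule H R M \<and> S \<subseteq> H}"

locale noetherian_module = module +
  assumes ascending_chain:
    "\<lbrakk>\<And>n. submodule (N n) R M; \<And>n. N n \<subseteq> N (Suc n)\<rbrakk> \<Longrightarrow> \<exists>k::nat. \<forall>n\<ge>k. N n = N k"

locale artinian_module = module +
  assumes descending_chain:
    "\<lbrakk>\<And>n. submodule (N n) R M; \<And>n. N (Suc n) \<subseteq> N n\<rbrakk> \<Longrightarrow> \<exists>k::nat. \<forall>n\<ge>k. N n = N k"

locale finite_length_module = noetherian_module + artinian_module

section \<open>Linear relations\<close>

definition linear_relation ::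
    "('r, 's) ring_scheme \<Rightarrow> ('r, 'a, 'm) module_scheme \<Rightarrow> ('r, 'b, 'n) module_scheme
      \<Rightarrow> ('a \<times> 'b) set \<Rightarrow> bool"
  where "linear_relation R M N \<phi> \<longleftrightarrow> submodule \<phi> R (module_sum M N)"

text \<open>The library's \<open>\<alpha> ^^ k\<close> does not fit, since \<open>\<alpha> ^^ 0\<close> is the identity of the whole type
  rather than of the carrier.\<close>

primrec rel_power :: "('r, 'a, 'm) module_scheme \<Rightarrow> ('a \<times> 'a) set \<Rightarrow> nat \<Rightarrow> ('a \<times> 'a) set"
  where
    "rel_power A \<alpha> 0 = Id_on (carrier A)"
  | "rel_power A \<alpha> (Suc k) = rel_power A \<alpha> k O \<alpha>"

definition rel_int_power :: "('r, 'a, 'm) module_scheme \<Rightarrow> ('a \<times> 'a) set \<Rightarrow> int \<Rightarrow> ('a \<times> 'a) set"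
  where "rel_int_power A \<alpha> l =
    (if l \<ge> 0 then rel_power A \<alpha> (nat l) else rel_power A (\<alpha>\<inverse>) (nat (- l)))"

section \<open>The categories End(FRel(R)) and Szym(FRel(R))\<close>

type_synonym ('r, 'a, 'm) endo = "('r, 'a, 'm) module_scheme \<times> ('a \<times> 'a) set"

definition end_frel_obj :: "('r, 's) ring_scheme \<Rightarrow> ('r, 'a, 'm) endo \<Rightarrow> bool"
  where "end_frel_obj R = (\<lambda>(A, \<alpha>). finite_length_module R A \<and> linear_relation R A A \<alpha>)"

definition end_hom ::
    "('r, 's) ring_scheme \<Rightarrow> ('r, 'a, 'm) endo \<Rightarrow> ('r, 'b, 'n) endo \<Rightarrow> ('a \<times> 'b) set set"
  where "end_hom R = (\<lambda>(A, \<alpha>) (B, \<beta>). {\<phi>. linear_relation R A B \<phi> \<and> \<alpha> O \<phi> = \<phi> O \<beta>})"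

definition szym_equiv ::
    "('r, 's) ring_scheme \<Rightarrow> ('r, 'a, 'm) endo \<Rightarrow> ('r, 'b, 'n) endo
      \<Rightarrow> ((('a \<times> 'b) set \<times> nat) \<times> (('a \<times> 'b) set \<times> nat)) set"
  where "szym_equiv R = (\<lambda>(A, \<alpha>) Y.
    {((\<phi>, n), (\<psi>, m)). \<phi> \<in> end_hom R (A, \<alpha>) Y \<and> \<psi> \<in> end_hom R (A, \<alpha>) Y \<and>
      (\<exists>k. rel_power A \<alpha> (m + k) O \<phi> = rel_power A \<alpha> (n + k) O \<psi>)})"

definition szym_class ::
    "('r, 's) ring_scheme \<Rightarrow> ('r, 'a, 'm) endo \<Rightarrow> ('r, 'b, 'n) endo
      \<Rightarrow> ('a \<times> 'b) set \<Rightarrow> nat \<Rightarrow> (('a \<times> 'b) set \<times> nat) set"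
  where "szym_class R X Y \<phi> n = szym_equiv R X Y `` {(\<phi>, n)}"

definition szym_hom ::
    "('r, 's) ring_scheme \<Rightarrow> ('r, 'a, 'm) endo \<Rightarrow> ('r, 'b, 'n) endo
      \<Rightarrow> (('a \<times> 'b) set \<times> nat) set set"
  where "szym_hom R X Y = (end_hom R X Y \<times> UNIV) // szym_equiv R X Y"

text \<open>The composite \<open>G \<circ> F\<close> of \<open>F : X \<rightarrow> Y\<close> and \<open>G : Y \<rightarrow> Z\<close>, as the union over all choices of
  representatives; lemma \<open>szym_comp_class\<close> below shows that all choices give the same class.\<close>

definition szym_comp ::
    "('r, 's) ring_scheme \<Rightarrow> ('r, 'a, 'm) endo \<Rightarrow> ('r, 'c, 'o) endo
      \<Rightarrow> (('b \<times> 'c) set \<times> nat) set \<Rightarrow> (('a \<times> 'b) set \<times> nat) set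
      \<Rightarrow> (('a \<times> 'c) set \<times> nat) set"
  where "szym_comp R X Z G F =
    (\<Union>(\<psi>, m)\<in>G. \<Union>(\<phi>, n)\<in>F. szym_class R X Z (\<phi> O \<psi>) (m + n))"

definition szym_id ::
    "('r, 's) ring_scheme \<Rightarrow> ('r, 'a, 'm) endo \<Rightarrow> (('a \<times> 'a) set \<times> nat) set"
  where "szym_id R X = szym_class R X X (Id_on (carrier (fst X))) 0"

definition szym_frel_isomorphic ::
    "('r, 's) ring_scheme \<Rightarrow> ('r, 'a, 'm) endo \<Rightarrow> ('r, 'b, 'n) endo \<Rightarrow> bool"
  where "szym_frel_isomorphic R X Y \<longleftrightarrow>
    end_frel_obj R X \<and> end_frel_obj R Y \<and>
    (\<exists>F\<in>szym_hom R X Y. \<exists>G\<in>szym_hom R Y X.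
      szym_comp R X X G F = szym_id R X \<and> szym_comp R Y Y F G = szym_id R Y)"

section \<open>The Leray functor\<close>

definition gker :: "('r, 's) ring_scheme \<Rightarrow> ('r, 'a, 'm) endo \<Rightarrow> 'a set"
  where "gker R = (\<lambda>(A, \<alpha>).
    generated_submodule R A (\<Union>l::int. rel_int_power A \<alpha> l `` {\<zero>\<^bsub>A\<^esub>}))"

definition gim :: "('r, 'a, 'm) endo \<Rightarrow> 'a set"
  where "gim = (\<lambda>(A, \<alpha>). \<Inter>l::int. rel_int_power A \<alpha> l `` carrier A)"

definition gim_incl :: "('r, 'a, 'm) endo \<Rightarrow> ('a \<times> 'a) set"
  where "gim_incl X = {(x, x) |x. x \<in> gim X}"

definition gker_proj :: "('r, 's) ring_scheme \<Rightarrow> ('r, 'a, 'm) endo \<Rightarrow> ('a \<times> 'a set) set"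
  where "gker_proj R X = {(x, gker R X +>\<^bsub>fst X\<^esub> x) |x. x \<in> carrier (fst X)}"

text \<open>In each object \<open>(A, \<alpha>)\<close> the relation \<open>\<alpha>\<close> is an endomorphism of \<open>(A, \<alpha>)\<close>, so the object
  part of \<open>LE\<close> and \<open>LM\<close> is given by applying the morphism part to \<open>\<alpha>\<close>.\<close>

definition LE_mor :: "('r, 'a, 'm) endo \<Rightarrow> ('r, 'b, 'n) endo \<Rightarrow> ('a \<times> 'b) set \<Rightarrow> ('a \<times> 'b) set"
  where "LE_mor X Y \<phi> = gim_incl X O \<phi> O (gim_incl Y)\<inverse>"

definition LE_obj :: "('r, 'a, 'm) endo \<Rightarrow> ('r, 'a, 'm) endo"
  where "LE_obj X = ((fst X)\<lparr>carrier := gim X\<rparr>, LE_mor X X (snd X))"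

definition LM_mor ::
    "('r, 's) ring_scheme \<Rightarrow> ('r, 'a, 'm) endo \<Rightarrow> ('r, 'b, 'n) endo
      \<Rightarrow> ('a \<times> 'b) set \<Rightarrow> ('a set \<times> 'b set) set"
  where "LM_mor R X Y \<phi> = (gker_proj R X)\<inverse> O \<phi> O gker_proj R Y"

definition LM_obj :: "('r, 's) ring_scheme \<Rightarrow> ('r, 'a, 'm) endo \<Rightarrow> ('r, 'a set, unit) endo"
  where "LM_obj R X = (quotient_module (fst X) (gker R X), LM_mor R X X (snd X))"

definition Leray_mor ::
    "('r, 's) ring_scheme \<Rightarrow> ('r, 'a, 'm) endo \<Rightarrow> ('r, 'b, 'n) endo
      \<Rightarrow> ('a \<times> 'b) set \<Rightarrow> ('a set \<times> 'b set) set"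
  where "Leray_mor R X Y \<phi> = LE_mor (LM_obj R X) (LM_obj R Y) (LM_mor R X Y \<phi>)"

definition Leray_obj :: "('r, 's) ring_scheme \<Rightarrow> ('r, 'a, 'm) endo \<Rightarrow> ('r, 'a set, unit) endo"
  where "Leray_obj R X = LE_obj (LM_obj R X)"

section \<open>Well-definedness\<close>

lemma module_sum_simps [simp]:
  "carrier (module_sum M N) = carrier M \<times> carrier N"
  "\<zero>\<^bsub>module_sum M N\<^esub> = (\<zero>\<^bsub>M\<^esub>, \<zero>\<^bsub>N\<^esub>)"
  "(x, y) \<oplus>\<^bsub>module_sum M N\<^esub> (x', y') = (x \<oplus>\<^bsub>M\<^esub> x', y \<oplus>\<^bsub>N\<^esub> y')"
  "r \<odot>\<^bsub>module_sum M N\<^esub> (x, y) = (r \<odot>\<^bsub>M\<^esub> x, r \<odot>\<^bsub>N\<^esub> y)"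
  by (simp_all add: module_sum_def RDirProd_def DirProd_def
        module.defs ring.defs monoid.defs)

lemma module_module_sum:
  assumes "module R M" "module R N"
  shows "module R (module_sum M N)"
proof -
  interpret M: module R M by fact
  interpret N: module R N by fact
  show ?thesis
  proof (rule moduleI)
    show "cring R" by (rule M.is_cring)
    show "abelian_group (module_sum M N)"
    proof (rule abelian_groupI)
      fix p assume "p \<in> carrier (module_sum M N)"
      then show "\<exists>q\<in>carrier (module_sum M N). q \<oplus>\<^bsub>module_sum M N\<^esub> p = \<zero>\<^bsub>module_sum M N\<^esub>"
        by (intro bexI[of _ "(\<ominus>\<^bsub>M\<^esub> fst p, \<ominus>\<^bsub>N\<^esub> snd p)"]) (auto simp: M.M.l_neg N.M.l_neg)
    qed (auto simp: M.M.add.m_ac N.M.add.m_ac)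
  qed (auto simp: M.smult_l_distr N.smult_l_distr M.smult_r_distr N.smult_r_distr
        M.smult_assoc1 N.smult_assoc1)
qed

lemma linear_relation_iff:
  assumes "module R M" "module R N"
  shows "linear_relation R M N \<phi> \<longleftrightarrow>
    \<phi> \<subseteq> carrier M \<times> carrier N \<and> (\<zero>\<^bsub>M\<^esub>, \<zero>\<^bsub>N\<^esub>) \<in> \<phi> \<and>
    (\<forall>x y x' y'. (x, y) \<in> \<phi> \<longrightarrow> (x', y') \<in> \<phi> \<longrightarrow> (x \<oplus>\<^bsub>M\<^esub> x', y \<oplus>\<^bsub>N\<^esub> y') \<in> \<phi>) \<and>
    (\<forall>r x y. r \<in> carrier R \<longrightarrow> (x, y) \<in> \<phi> \<longrightarrow> (r \<odot>\<^bsub>M\<^esub> x, r \<odot>\<^bsub>N\<^esub> y) \<in> \<phi>)" (is "_ = ?rhs")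
proof -
  interpret S: module R "module_sum M N" using assms by (rule module_module_sum)
  show ?thesis
  proof
    assume "linear_relation R M N \<phi>"
    then have s: "submodule \<phi> R (module_sum M N)" by (simp add: linear_relation_def)
    then interpret S': subgroup \<phi> "add_monoid (module_sum M N)" by (rule submodule.axioms)
    show ?rhs
    proof (intro conjI allI impI)
      show "\<phi> \<subseteq> carrier M \<times> carrier N" using S.submoduleE(1)[OF s] by simp
      show "(\<zero>\<^bsub>M\<^esub>, \<zero>\<^bsub>N\<^esub>) \<in> \<phi>" using S'.one_closed by simp
    next
      fix x y x' y' assume "(x, y) \<in> \<phi>" "(x', y') \<in> \<phi>"
      from S.submoduleE(5)[OF s this] show "(x \<oplus>\<^bsub>M\<^esub> x', y \<oplus>\<^bsub>N\<^esub> y') \<in> \<phi>" by simp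
    next
      fix r x y assume "r \<in> carrier R" "(x, y) \<in> \<phi>"
      from S.submoduleE(4)[OF s this] show "(r \<odot>\<^bsub>M\<^esub> x, r \<odot>\<^bsub>N\<^esub> y) \<in> \<phi>" by simp
    qed
  next
    assume r: ?rhs
    have "\<ominus>\<^bsub>module_sum M N\<^esub> p \<in> \<phi>" if "p \<in> \<phi>" for p
    proof -
      have p: "p \<in> carrier (module_sum M N)" using r that by auto
      have "\<ominus>\<^bsub>module_sum M N\<^esub> p = (\<ominus>\<^bsub>R\<^esub> \<one>\<^bsub>R\<^esub>) \<odot>\<^bsub>module_sum M N\<^esub> p"
        using p by (simp only: S.smult_l_minus S.R.one_closed S.smult_one)
      also have "\<dots> \<in> \<phi>"
        using r that by (cases p) simp
      finally show ?thesis .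
    qed
    then show "linear_relation R M N \<phi>"
      unfolding linear_relation_def
    proof (intro S.submoduleI)
      show "\<phi> \<subseteq> carrier (module_sum M N)" "\<zero>\<^bsub>module_sum M N\<^esub> \<in> \<phi>" using r by simp_all
      show "p \<oplus>\<^bsub>module_sum M N\<^esub> q \<in> \<phi>" if "p \<in> \<phi>" "q \<in> \<phi>" for p q
        using r that by (cases p, cases q) simp
      show "a \<odot>\<^bsub>module_sum M N\<^esub> p \<in> \<phi>" if "a \<in> carrier R" "p \<in> \<phi>" for a p
        using r that by (cases p) simp
    qed
  qed
qed

lemma linear_relation_comp:
  assumes "module R M" "module R N" "module R P"
    and "linear_relation R M N \<phi>" "linear_relation R N P \<psi>"
  shows "linear_relation R M P (\<phi> O \<psi>)"
proof -
  note iff = linear_relation_iff[OF assms(1,2)] linear_relation_iff[OF assms(2,3)]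
    linear_relation_iff[OF assms(1,3)]
  have 1: "\<phi> \<subseteq> carrier M \<times> carrier N" "(\<zero>\<^bsub>M\<^esub>, \<zero>\<^bsub>N\<^esub>) \<in> \<phi>"
    "\<And>x y x' y'. (x, y) \<in> \<phi> \<Longrightarrow> (x', y') \<in> \<phi> \<Longrightarrow> (x \<oplus>\<^bsub>M\<^esub> x', y \<oplus>\<^bsub>N\<^esub> y') \<in> \<phi>"
    "\<And>r x y. r \<in> carrier R \<Longrightarrow> (x, y) \<in> \<phi> \<Longrightarrow> (r \<odot>\<^bsub>M\<^esub> x, r \<odot>\<^bsub>N\<^esub> y) \<in> \<phi>"
    using assms(4) unfolding iff by simp_all
  have 2: "\<psi> \<subseteq> carrier N \<times> carrier P" "(\<zero>\<^bsub>N\<^esub>, \<zero>\<^bsub>P\<^esub>) \<in> \<psi>"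
    "\<And>x y x' y'. (x, y) \<in> \<psi> \<Longrightarrow> (x', y') \<in> \<psi> \<Longrightarrow> (x \<oplus>\<^bsub>N\<^esub> x', y \<oplus>\<^bsub>P\<^esub> y') \<in> \<psi>"
    "\<And>r x y. r \<in> carrier R \<Longrightarrow> (x, y) \<in> \<psi> \<Longrightarrow> (r \<odot>\<^bsub>N\<^esub> x, r \<odot>\<^bsub>P\<^esub> y) \<in> \<psi>"
    using assms(5) unfolding iff by simp_all
  show ?thesis
    unfolding iff
  proof (intro conjI allI impI)
    show "\<phi> O \<psi> \<subseteq> carrier M \<times> carrier P" using 1(1) 2(1) by auto
    show "(\<zero>\<^bsub>M\<^esub>, \<zero>\<^bsub>P\<^esub>) \<in> \<phi> O \<psi>" using 1(2) 2(2) by (rule relcompI)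
  next
    fix x z x' z' assume "(x, z) \<in> \<phi> O \<psi>" "(x', z') \<in> \<phi> O \<psi>"
    then obtain y y' where "(x, y) \<in> \<phi>" "(y, z) \<in> \<psi>" "(x', y') \<in> \<phi>" "(y', z') \<in> \<psi>"
      by (elim relcompE) auto
    then show "(x \<oplus>\<^bsub>M\<^esub> x', z \<oplus>\<^bsub>P\<^esub> z') \<in> \<phi> O \<psi>"
      by (intro relcompI[OF 1(3) 2(3)])
  next
    fix r x z assume r: "r \<in> carrier R" and "(x, z) \<in> \<phi> O \<psi>"
    then obtain y where "(x, y) \<in> \<phi>" "(y, z) \<in> \<psi>"
      by (elim relcompE) auto
    then show "(r \<odot>\<^bsub>M\<^esub> x, r \<odot>\<^bsub>P\<^esub> z) \<in> \<phi> O \<psi>"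
      using r by (intro relcompI[OF 1(4) 2(4)])
  qed
qed

lemma linear_relation_Id_on:
  assumes "module R M"
  shows "linear_relation R M M (Id_on (carrier M))"
proof -
  interpret module R M by fact
  show ?thesis unfolding linear_relation_iff[OF assms assms] by auto
qed

lemma quotient_module_simps [simp]:
  "carrier (quotient_module M H) = a_rcosets\<^bsub>M\<^esub> H"
  "\<zero>\<^bsub>quotient_module M H\<^esub> = H"
  "X \<oplus>\<^bsub>quotient_module M H\<^esub> Y = X <+>\<^bsub>M\<^esub> Y"
  "r \<odot>\<^bsub>quotient_module M H\<^esub> X = (\<Union>x\<in>X. H +>\<^bsub>M\<^esub> (r \<odot>\<^bsub>M\<^esub> x))"
  by (simp_all add: quotient_module_def FactRing_def module.defs ring.defs)

lemma quotient_module_smult: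
  assumes "module R M" "submodule H R M" "r \<in> carrier R" "x \<in> carrier M"
  shows "r \<odot>\<^bsub>quotient_module M H\<^esub> (H +>\<^bsub>M\<^esub> x) = H +>\<^bsub>M\<^esub> (r \<odot>\<^bsub>M\<^esub> x)"
proof -
  interpret module R M by fact
  interpret H: subgroup H "add_monoid M" using assms(2) by (rule submodule.axioms)
  have sub: "H \<subseteq> carrier M" using H.subset by simp
  interpret H': abelian_subgroup H M
    using H.subgroup_axioms M.abelian_group_axioms
    by (intro abelian_subgroupI3 additive_subgroup.intro)
  have eq: "H +>\<^bsub>M\<^esub> (r \<odot>\<^bsub>M\<^esub> y) = H +>\<^bsub>M\<^esub> (r \<odot>\<^bsub>M\<^esub> x)" if y: "y \<in> H +>\<^bsub>M\<^esub> x" for y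
  proof -
    obtain h where h: "h \<in> H" "y = h \<oplus>\<^bsub>M\<^esub> x"
      using y unfolding a_r_coset_def' by blast
    have hc: "h \<in> carrier M" using h sub by auto
    have "r \<odot>\<^bsub>M\<^esub> y = r \<odot>\<^bsub>M\<^esub> h \<oplus>\<^bsub>M\<^esub> r \<odot>\<^bsub>M\<^esub> x"
      unfolding h(2) using assms(3) hc assms(4) by (rule smult_r_distr)
    moreover have "r \<odot>\<^bsub>M\<^esub> h \<in> H"
      using assms(3) h(1) by (rule submodule.smult_closed[OF assms(2)])
    ultimately have "r \<odot>\<^bsub>M\<^esub> y \<in> H +>\<^bsub>M\<^esub> (r \<odot>\<^bsub>M\<^esub> x)"
      unfolding a_r_coset_def' by (intro UN_I) simp_all
    then show ?thesis
      using assms(3,4) by (intro H'.a_repr_independence'[symmetric] smult_closed)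
  qed
  have ne: "H +>\<^bsub>M\<^esub> x \<noteq> {}" using H'.a_rcos_self[OF assms(4)] by blast
  show ?thesis
    unfolding quotient_module_simps by (rule SUP_eq_const[OF ne eq])
qed

lemma module_quotient_module:
  assumes "module R M" "submodule H R M"
  shows "module R (quotient_module M H)"
proof -
  interpret module R M by fact
  interpret H: subgroup H "add_monoid M" using assms(2) by (rule submodule.axioms)
  interpret H': abelian_subgroup H M
    using H.subgroup_axioms M.abelian_group_axioms
    by (intro abelian_subgroupI3 additive_subgroup.intro)
  have add: "(H +>\<^bsub>M\<^esub> x) \<oplus>\<^bsub>quotient_module M H\<^esub> (H +>\<^bsub>M\<^esub> y) = H +>\<^bsub>M\<^esub> (x \<oplus>\<^bsub>M\<^esub> y)"
    if "x \<in> carrier M" "y \<in> carrier M" for x y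
    unfolding quotient_module_simps using that by (rule H'.a_rcos_sum)
  have coset: "H +>\<^bsub>M\<^esub> x \<in> carrier (quotient_module M H)" if "x \<in> carrier M" for x
    unfolding quotient_module_simps using H'.a_subset that by (rule M.a_rcosetsI)
  have cosetE: "\<exists>x\<in>carrier M. X = H +>\<^bsub>M\<^esub> x" if "X \<in> carrier (quotient_module M H)" for X
    using that unfolding quotient_module_simps A_RCOSETS_def' by blast
  have zero: "\<zero>\<^bsub>quotient_module M H\<^esub> = H +>\<^bsub>M\<^esub> \<zero>\<^bsub>M\<^esub>"
    unfolding quotient_module_simps by (rule M.a_coset_add_zero[OF H'.a_subset, symmetric])
  note smult = quotient_module_smult[OF assms]
  note [simp del] = quotient_module_simps
  show ?thesis
  proof (rule moduleI)
    show "cring R" by (rule is_cring)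
    show "abelian_group (quotient_module M H)"
    proof (rule abelian_groupI)
      fix X Y Z
      assume XYZ: "X \<in> carrier (quotient_module M H)" "Y \<in> carrier (quotient_module M H)"
      then obtain x y where x: "x \<in> carrier M" "X = H +>\<^bsub>M\<^esub> x"
        and y: "y \<in> carrier M" "Y = H +>\<^bsub>M\<^esub> y"
        using cosetE by metis
      show "X \<oplus>\<^bsub>quotient_module M H\<^esub> Y \<in> carrier (quotient_module M H)"
        unfolding x(2) y(2) add[OF x(1) y(1)] using x y by (intro coset M.a_closed)
      show "X \<oplus>\<^bsub>quotient_module M H\<^esub> Y = Y \<oplus>\<^bsub>quotient_module M H\<^esub> X"
        unfolding x(2) y(2) add[OF x(1) y(1)] add[OF y(1) x(1)]
        by (simp only: M.a_comm[OF x(1) y(1)])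
      assume "Z \<in> carrier (quotient_module M H)"
      then obtain z where z: "z \<in> carrier M" "Z = H +>\<^bsub>M\<^esub> z"
        using cosetE by metis
      show "(X \<oplus>\<^bsub>quotient_module M H\<^esub> Y) \<oplus>\<^bsub>quotient_module M H\<^esub> Z
          = X \<oplus>\<^bsub>quotient_module M H\<^esub> (Y \<oplus>\<^bsub>quotient_module M H\<^esub> Z)"
        unfolding x(2) y(2) z(2) by (simp only: add x(1) y(1) z(1) M.a_closed M.a_assoc)
    next
      show "\<zero>\<^bsub>quotient_module M H\<^esub> \<in> carrier (quotient_module M H)"
        unfolding zero by (intro coset M.zero_closed)
    next
      fix X assume "X \<in> carrier (quotient_module M H)"
      then obtain x where x: "x \<in> carrier M" "X = H +>\<^bsub>M\<^esub> x" using cosetE by blast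
      show "\<zero>\<^bsub>quotient_module M H\<^esub> \<oplus>\<^bsub>quotient_module M H\<^esub> X = X"
        unfolding zero x(2) by (simp only: add x(1) M.zero_closed M.l_zero)
      have "(H +>\<^bsub>M\<^esub> (\<ominus>\<^bsub>M\<^esub> x)) \<oplus>\<^bsub>quotient_module M H\<^esub> X = \<zero>\<^bsub>quotient_module M H\<^esub>"
        unfolding zero x(2) by (simp only: add x(1) M.a_inv_closed M.l_neg)
      then show "\<exists>Y\<in>carrier (quotient_module M H).
          Y \<oplus>\<^bsub>quotient_module M H\<^esub> X = \<zero>\<^bsub>quotient_module M H\<^esub>"
        using coset[OF M.a_inv_closed[OF x(1)]] by blast
    qed
  next
    fix r X
    assume r: "r \<in> carrier R" and "X \<in> carrier (quotient_module M H)"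
    then obtain x where x: "x \<in> carrier M" "X = H +>\<^bsub>M\<^esub> x" using cosetE by blast
    show "r \<odot>\<^bsub>quotient_module M H\<^esub> X \<in> carrier (quotient_module M H)"
      unfolding x(2) smult[OF r x(1)] using r x(1) by (intro coset smult_closed)
    fix s assume s: "s \<in> carrier R"
    show "(r \<oplus>\<^bsub>R\<^esub> s) \<odot>\<^bsub>quotient_module M H\<^esub> X
        = r \<odot>\<^bsub>quotient_module M H\<^esub> X \<oplus>\<^bsub>quotient_module M H\<^esub> s \<odot>\<^bsub>quotient_module M H\<^esub> X"
      unfolding x(2)
      by (simp only: smult add r s x(1) R.a_closed smult_closed smult_l_distr)
    show "(r \<otimes>\<^bsub>R\<^esub> s) \<odot>\<^bsub>quotient_module M H\<^esub> X
        = r \<odot>\<^bsub>quotient_module M H\<^esub> (s \<odot>\<^bsub>quotient_module M H\<^esub> X)"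
      unfolding x(2)
      by (simp only: smult r s x(1) R.m_closed smult_closed smult_assoc1)
  next
    fix r X Y
    assume r: "r \<in> carrier R"
      and XY: "X \<in> carrier (quotient_module M H)" "Y \<in> carrier (quotient_module M H)"
    then obtain x y where x: "x \<in> carrier M" "X = H +>\<^bsub>M\<^esub> x"
      and y: "y \<in> carrier M" "Y = H +>\<^bsub>M\<^esub> y"
      using cosetE by metis
    show "r \<odot>\<^bsub>quotient_module M H\<^esub> (X \<oplus>\<^bsub>quotient_module M H\<^esub> Y)
        = r \<odot>\<^bsub>quotient_module M H\<^esub> X \<oplus>\<^bsub>quotient_module M H\<^esub> r \<odot>\<^bsub>quotient_module M H\<^esub> Y"
      unfolding x(2) y(2)
      by (simp only: smult add r x(1) y(1) M.a_closed smult_closed smult_r_distr)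
  next
    fix X assume "X \<in> carrier (quotient_module M H)"
    then obtain x where x: "x \<in> carrier M" "X = H +>\<^bsub>M\<^esub> x" using cosetE by blast
    show "\<one>\<^bsub>R\<^esub> \<odot>\<^bsub>quotient_module M H\<^esub> X = X"
      unfolding x(2) by (simp only: smult x(1) R.one_closed smult_one)
  qed
qed

lemma rel_power_add:
  assumes "\<alpha> \<subseteq> carrier A \<times> carrier A"
  shows "rel_power A \<alpha> (m + n) = rel_power A \<alpha> m O rel_power A \<alpha> n"
proof (induction n)
  case 0
  have "rel_power A \<alpha> m \<subseteq> carrier A \<times> carrier A"
    using assms by (induction m) auto
  then show ?case by auto
qed (simp add: O_assoc)

lemma end_hom_rel_power:
  assumes "end_frel_obj R (A, \<alpha>)" "end_frel_obj R (B, \<beta>)" "\<phi> \<in> end_hom R (A, \<alpha>) (B, \<beta>)"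
  shows "rel_power A \<alpha> k O \<phi> = \<phi> O rel_power B \<beta> k"
proof (induction k)
  case 0
  have "module R A" "module R B"
    using assms(1,2) by (auto simp: end_frel_obj_def finite_length_module_def artinian_module_def)
  then have "\<phi> \<subseteq> carrier A \<times> carrier B"
    using assms(3) by (auto simp: end_hom_def linear_relation_iff)
  then show ?case by auto
next
  case (Suc k)
  have "rel_power A \<alpha> (Suc k) O \<phi> = rel_power A \<alpha> k O \<phi> O \<beta>"
    using assms(3) by (simp add: end_hom_def O_assoc)
  also have "\<dots> = \<phi> O rel_power B \<beta> (Suc k)"
    by (simp flip: O_assoc add: Suc.IH)
  finally show ?case .
qed

lemma end_hom_comp:
  assumes "end_frel_obj R X" "end_frel_obj R Y" "end_frel_obj R Z"
    and "\<phi> \<in> end_hom R X Y" "\<psi> \<in> end_hom R Y Z"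
  shows "\<phi> O \<psi> \<in> end_hom R X Z"
proof -
  have "module R (fst X)" "module R (fst Y)" "module R (fst Z)"
    using assms(1-3)
    by (auto simp: end_frel_obj_def finite_length_module_def artinian_module_def split_beta)
  then have "linear_relation R (fst X) (fst Z) (\<phi> O \<psi>)"
    using assms(4,5) by (auto intro: linear_relation_comp simp: end_hom_def split_beta)
  moreover have "snd X O \<phi> = \<phi> O snd Y" "snd Y O \<psi> = \<psi> O snd Z"
    using assms(4,5) by (simp_all add: end_hom_def split_beta)
  then have "snd X O \<phi> O \<psi> = (\<phi> O \<psi>) O snd Z"
    by (metis O_assoc)
  ultimately show ?thesis
    by (simp add: end_hom_def split_beta)
qed

lemma equiv_szym_equiv:
  assumes "end_frel_obj R X" "end_frel_obj R Y"
  shows "equiv (end_hom R X Y \<times> UNIV) (szym_equiv R X Y)"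
proof -
  obtain A \<alpha> where X: "X = (A, \<alpha>)" by (cases X)
  have "module R A" using assms(1)
    by (auto simp: X end_frel_obj_def finite_length_module_def artinian_module_def)
  then have "\<alpha> \<subseteq> carrier A \<times> carrier A"
    using assms(1) by (auto simp: X end_frel_obj_def linear_relation_iff)
  note padd = rel_power_add[OF this]
  show ?thesis
  proof (rule equivI)
    show "szym_equiv R X Y \<subseteq> (end_hom R X Y \<times> UNIV) \<times> (end_hom R X Y \<times> UNIV)"
      by (auto simp: szym_equiv_def X)
    show "refl_on (end_hom R X Y \<times> UNIV) (szym_equiv R X Y)"
      by (auto simp: refl_on_def szym_equiv_def X)
    show "sym (szym_equiv R X Y)"
      by (fastforce simp: sym_def szym_equiv_def X)
    show "trans (szym_equiv R X Y)"
    proof (rule transI)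
      fix p q r assume pq: "(p, q) \<in> szym_equiv R X Y" and qr: "(q, r) \<in> szym_equiv R X Y"
      obtain \<phi> n \<psi> m \<chi> l where p: "p = (\<phi>, n)" "q = (\<psi>, m)" "r = (\<chi>, l)"
        by (cases p, cases q, cases r) auto
      obtain k where k: "rel_power A \<alpha> (m + k) O \<phi> = rel_power A \<alpha> (n + k) O \<psi>"
        using pq by (auto simp: p X szym_equiv_def)
      obtain j where j: "rel_power A \<alpha> (l + j) O \<psi> = rel_power A \<alpha> (m + j) O \<chi>"
        using qr by (auto simp: p X szym_equiv_def)
      let ?P = "rel_power A \<alpha>"
      have "?P (l + (m + k + j)) O \<phi> = ?P (l + j) O ?P (m + k) O \<phi>"
        by (simp add: padd[symmetric] O_assoc[symmetric] add_ac)
      also have "\<dots> = ?P (n + k) O ?P (l + j) O \<psi>"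
        unfolding k by (simp add: padd[symmetric] O_assoc[symmetric] add_ac)
      also have "\<dots> = ?P (n + (m + k + j)) O \<chi>"
        unfolding j by (simp add: padd[symmetric] O_assoc[symmetric] add_ac)
      finally show "(p, r) \<in> szym_equiv R X Y"
        using pq qr by (auto simp: p X szym_equiv_def)
    qed
  qed
qed

lemma szym_equiv_comp:
  assumes obj: "end_frel_obj R X" "end_frel_obj R Y" "end_frel_obj R Z"
    and 1: "((\<phi>, n), (\<phi>', n')) \<in> szym_equiv R X Y"
    and 2: "((\<psi>, m), (\<psi>', m')) \<in> szym_equiv R Y Z"
  shows "((\<phi> O \<psi>, m + n), (\<phi>' O \<psi>', m' + n')) \<in> szym_equiv R X Z"
proof -
  obtain A \<alpha> B \<beta> where X: "X = (A, \<alpha>)" and Y: "Y = (B, \<beta>)" by (cases X, cases Y)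
  have hom: "\<phi> \<in> end_hom R X Y" "\<phi>' \<in> end_hom R X Y" "\<psi> \<in> end_hom R Y Z" "\<psi>' \<in> end_hom R Y Z"
    using 1 2 by (auto simp: szym_equiv_def X Y)
  have "module R A" using obj(1)
    by (auto simp: X end_frel_obj_def finite_length_module_def artinian_module_def)
  then have "\<alpha> \<subseteq> carrier A \<times> carrier A"
    using obj(1) by (auto simp: X end_frel_obj_def linear_relation_iff)
  note padd = rel_power_add[OF this]
  note comm = end_hom_rel_power[OF obj(1,2)[unfolded X Y]]
  let ?P = "rel_power A \<alpha>" and ?Q = "rel_power B \<beta>"
  obtain k where k: "?P (n' + k) O \<phi> = ?P (n + k) O \<phi>'"
    using 1 by (auto simp: X szym_equiv_def)
  obtain j where j: "?Q (m' + j) O \<psi> = ?Q (m + j) O \<psi>'"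
    using 2 by (auto simp: Y szym_equiv_def)
  have "?P (m' + n' + (k + j)) O \<phi> O \<psi> = ?P (m' + j) O (?P (n' + k) O \<phi>) O \<psi>"
    by (simp add: padd[symmetric] O_assoc[symmetric] add_ac)
  also have "\<dots> = ?P (n + k) O (?P (m' + j) O \<phi>') O \<psi>"
    unfolding k by (simp add: padd[symmetric] O_assoc[symmetric] add_ac)
  also have "\<dots> = ?P (n + k) O \<phi>' O ?Q (m' + j) O \<psi>"
    using hom(2) by (simp add: comm X Y O_assoc)
  also have "\<dots> = ?P (n + k) O (\<phi>' O ?Q (m + j)) O \<psi>'"
    unfolding j by (simp add: O_assoc)
  also have "\<dots> = ?P (n + k) O ?P (m + j) O \<phi>' O \<psi>'"
    using hom(2) by (simp add: comm[symmetric] X Y O_assoc)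
  also have "\<dots> = ?P (m + n + (k + j)) O \<phi>' O \<psi>'"
    by (simp add: padd[symmetric] O_assoc[symmetric] add_ac)
  finally have "\<exists>k. ?P (m' + n' + k) O \<phi> O \<psi> = ?P (m + n + k) O \<phi>' O \<psi>'" by blast
  then show ?thesis
    using end_hom_comp[OF obj hom(1,3)] end_hom_comp[OF obj hom(2,4)]
    by (simp add: szym_equiv_def X)
qed

lemma szym_comp_class:
  assumes obj: "end_frel_obj R X" "end_frel_obj R Y" "end_frel_obj R Z"
    and hom: "\<phi> \<in> end_hom R X Y" "\<psi> \<in> end_hom R Y Z"
  shows "szym_comp R X Z (szym_class R Y Z \<psi> m) (szym_class R X Y \<phi> n)
    = szym_class R X Z (\<phi> O \<psi>) (m + n)"
proof -
  have self: "(\<psi>, m) \<in> szym_class R Y Z \<psi> m" "(\<phi>, n) \<in> szym_class R X Y \<phi> n"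
    unfolding szym_class_def using hom obj
    by (intro equiv_class_self[OF equiv_szym_equiv]; simp)+
  have eq: "szym_class R X Z (\<phi>' O \<psi>') (m' + n') = szym_class R X Z (\<phi> O \<psi>) (m + n)"
    if "(\<psi>', m') \<in> szym_class R Y Z \<psi> m" "(\<phi>', n') \<in> szym_class R X Y \<phi> n" for \<phi>' n' \<psi>' m'
    unfolding szym_class_def using that
    by (intro equiv_class_eq[OF equiv_szym_equiv[OF obj(1,3)], symmetric] szym_equiv_comp[OF obj])
      (auto simp: szym_class_def)
  show ?thesis
  proof
    show "szym_comp R X Z (szym_class R Y Z \<psi> m) (szym_class R X Y \<phi> n)
        \<subseteq> szym_class R X Z (\<phi> O \<psi>) (m + n)"
      unfolding szym_comp_def by (clarsimp simp: eq)
    show "szym_class R X Z (\<phi> O \<psi>) (m + n)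
        \<subseteq> szym_comp R X Z (szym_class R Y Z \<psi> m) (szym_class R X Y \<phi> n)"
      unfolding szym_comp_def using self by fastforce
  qed
qed

end

theory Submission
  imports Defs
begin

text \<open>In the Szymczak category every \<open>\<alpha>\<close> becomes invertible as an endomorphism of \<open>(A, \<alpha>)\<close>. Hence
  two objects are isomorphic there as soon as they are shift equivalent, that is, as soon as there
  are morphisms in both directions whose two composites are powers of the respective endorelations
  with the same exponent. Shift equivalence is transitive, so it suffices to relate \<open>(A, \<alpha>)\<close> to
  \<open>LM (A, \<alpha>)\<close>, and any object of finite length to its image under \<open>LE\<close>.

  Neither the projection \<open>\<pi>\<close> to \<open>A / gker \<alpha>\<close> nor the inclusion \<open>\<iota>\<close> of \<open>gim \<alpha>\<close> commutes with the
  endorelations in general, but they do after composition with a high power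
  \<open>\<alpha>\<^sup>N\<close>. With \<open>e = \<pi>\<close> or \<open>e = \<iota>\<inverse>\<close> the shift equivalence is given by \<open>e \<circ> \<alpha>\<^sup>N\<close> and \<open>\<alpha>\<^sup>N \<circ> e\<inverse>\<close>; both
  cases rest on the fact that \<open>e\<inverse> \<circ> e\<close> may be left out between suitable relations
  (\<open>compression_shift_equivalent\<close>).

  For \<open>\<iota>\<close> this means that the middle point of a path through \<open>A\<close> lies in \<open>gim \<alpha>\<close>. The descending
  chain condition gives \<open>gim \<alpha> = \<alpha>\<^sup>N(A) \<inter> \<alpha>\<^sup>-\<^sup>N(A)\<close> for large \<open>N\<close>, so a point with \<open>N\<close> steps behind it
  and \<open>N\<close> steps ahead of it lies in \<open>gim \<alpha>\<close>. For \<open>\<pi>\<close> it means that a path may be broken at a point by a jump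
  by an element of \<open>gker \<alpha>\<close>. The ascending chain condition gives
  \<open>gker \<alpha> = \<alpha>\<^sup>N(0) + \<alpha>\<^sup>-\<^sup>N(0)\<close>. An element of \<open>\<alpha>\<^sup>N(0)\<close> has a history that starts in \<open>0\<close>, so a jump by it
  can be moved backwards along the path until it is absorbed, either by the zero at the start of its
  history or by \<open>\<pi>\<close>; a jump by an element of \<open>\<alpha>\<^sup>-\<^sup>N(0)\<close> can be moved forwards in the same way.\<close>

section \<open>Linear relations and submodules\<close>

text \<open>Closure under negation is automatic, as \<open>- x\<close> is the multiple of \<open>x\<close> by the scalar \<open>- 1\<close>.\<close>

lemma (in module) submodule_if_closed:
  assumes sub: "H \<subseteq> carrier M" and zero: "\<zero>\<^bsub>M\<^esub> \<in> H"
    and add: "\<And>x y. x \<in> H \<Longrightarrow> y \<in> H \<Longrightarrow> x \<oplus>\<^bsub>M\<^esub> y \<in> H"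
    and smult: "\<And>r x. r \<in> carrier R \<Longrightarrow> x \<in> H \<Longrightarrow> r \<odot>\<^bsub>M\<^esub> x \<in> H"
  shows "submodule H R M"
proof (rule submoduleI[OF sub zero _ add smult])
  fix x assume x: "x \<in> H"
  then have "\<ominus>\<^bsub>M\<^esub> x = (\<ominus>\<^bsub>R\<^esub> \<one>\<^bsub>R\<^esub>) \<odot>\<^bsub>M\<^esub> x"
    using sub by (auto simp: smult_l_minus)
  then show "\<ominus>\<^bsub>M\<^esub> x \<in> H"
    using smult[OF R.a_inv_closed[OF R.one_closed] x] by simp
qed

lemma (in module) submodule_zero_mem:
  assumes "submodule H R M"
  shows "\<zero>\<^bsub>M\<^esub> \<in> H"
  using subgroup.one_closed[OF submodule.axioms(1)[OF assms]] by simp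

lemma (in module) submodule_inter:
  assumes "\<S> \<noteq> {}" "\<And>H. H \<in> \<S> \<Longrightarrow> submodule H R M"
  shows "submodule (\<Inter>\<S>) R M"
proof (rule submodule_if_closed)
  show "\<Inter>\<S> \<subseteq> carrier M" using assms submoduleE(1) by blast
qed (auto simp: assms(2) submodule_zero_mem submoduleE(4,5))

lemma (in module) submodule_set_add:
  assumes H: "submodule H R M" and H': "submodule H' R M"
  shows "submodule {x \<oplus>\<^bsub>M\<^esub> y |x y. x \<in> H \<and> y \<in> H'} R M" (is "submodule ?S R M")
proof (rule submodule_if_closed)
  note sub = submoduleE(1)[OF H, THEN subsetD] submoduleE(1)[OF H', THEN subsetD]
  show "?S \<subseteq> carrier M" using sub by auto
  show "\<zero>\<^bsub>M\<^esub> \<in> ?S"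
    using submodule_zero_mem[OF H] submodule_zero_mem[OF H'] by force
  show "a \<oplus>\<^bsub>M\<^esub> b \<in> ?S" if a: "a \<in> ?S" and b: "b \<in> ?S" for a b
  proof -
    obtain x y where xy: "a = x \<oplus>\<^bsub>M\<^esub> y" "x \<in> H" "y \<in> H'" using a by blast
    obtain u v where uv: "b = u \<oplus>\<^bsub>M\<^esub> v" "u \<in> H" "v \<in> H'" using b by blast
    have "a \<oplus>\<^bsub>M\<^esub> b = (x \<oplus>\<^bsub>M\<^esub> u) \<oplus>\<^bsub>M\<^esub> (y \<oplus>\<^bsub>M\<^esub> v)"
      using xy uv sub by (simp add: M.add.m_ac)
    then show ?thesis
      using submoduleE(5)[OF H xy(2) uv(2)] submoduleE(5)[OF H' xy(3) uv(3)] by blast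
  qed
  show "r \<odot>\<^bsub>M\<^esub> a \<in> ?S" if r: "r \<in> carrier R" and a: "a \<in> ?S" for r a
  proof -
    obtain x y where xy: "a = x \<oplus>\<^bsub>M\<^esub> y" "x \<in> H" "y \<in> H'" using a by blast
    have "r \<odot>\<^bsub>M\<^esub> a = r \<odot>\<^bsub>M\<^esub> x \<oplus>\<^bsub>M\<^esub> r \<odot>\<^bsub>M\<^esub> y"
      using xy sub r by (simp add: smult_r_distr)
    then show ?thesis
      using submoduleE(4)[OF H r xy(2)] submoduleE(4)[OF H' r xy(3)] by blast
  qed
qed

lemma linear_relationD:
  assumes "module R M" "module R N" "linear_relation R M N \<phi>"
  shows "\<phi> \<subseteq> carrier M \<times> carrier N" "(\<zero>\<^bsub>M\<^esub>, \<zero>\<^bsub>N\<^esub>) \<in> \<phi>"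
    "(x, y) \<in> \<phi> \<Longrightarrow> (x', y') \<in> \<phi> \<Longrightarrow> (x \<oplus>\<^bsub>M\<^esub> x', y \<oplus>\<^bsub>N\<^esub> y') \<in> \<phi>"
    "r \<in> carrier R \<Longrightarrow> (x, y) \<in> \<phi> \<Longrightarrow> (r \<odot>\<^bsub>M\<^esub> x, r \<odot>\<^bsub>N\<^esub> y) \<in> \<phi>"
  using assms by (auto simp: linear_relation_iff)

lemma linear_relation_converse:
  assumes "module R M" "module R N" "linear_relation R M N \<phi>"
  shows "linear_relation R N M (\<phi>\<inverse>)"
  using linear_relationD[OF assms]
  by (auto simp: linear_relation_iff[OF assms(2,1)])

lemma submodule_image_linear_relation:
  assumes M: "module R M" and N: "module R N" and \<phi>: "linear_relation R M N \<phi>"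
    and H: "submodule H R M"
  shows "submodule (\<phi> `` H) R N"
proof -
  interpret M: module R M by fact
  interpret N: module R N by fact
  note lin = linear_relationD[OF M N \<phi>]
  show ?thesis
  proof (rule N.submodule_if_closed)
    show "\<phi> `` H \<subseteq> carrier N" using lin(1) by blast
    show "\<zero>\<^bsub>N\<^esub> \<in> \<phi> `` H" using lin(2) M.submodule_zero_mem[OF H] by blast
  qed (meson ImageE ImageI lin(3,4) M.submoduleE(4,5)[OF H])+
qed

lemma submodule_Domain:
  assumes "module R M" "module R N" "linear_relation R M N \<phi>"
  shows "submodule (Domain \<phi>) R M"
proof -
  interpret M: module R M by fact
  show ?thesis
    using linear_relationD[OF assms]
    by (intro M.submodule_if_closed) (blast elim!: DomainE)+
qed

lemma submodule_zero:
  assumes "module R M"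
  shows "submodule {\<zero>\<^bsub>M\<^esub>} R M"
proof -
  interpret module R M by fact
  show ?thesis by (rule submodule_if_closed) auto
qed

section \<open>Shift equivalence and the Szymczak category\<close>

definition shift_equivalent ::
    "('r, 's) ring_scheme \<Rightarrow> ('r, 'a, 'm) endo \<Rightarrow> ('r, 'b, 'n) endo \<Rightarrow> bool"
  where "shift_equivalent R X Y \<longleftrightarrow>
    (\<exists>\<phi>\<in>end_hom R X Y. \<exists>\<psi>\<in>end_hom R Y X. \<exists>n.
      \<phi> O \<psi> = rel_power (fst X) (snd X) n \<and> \<psi> O \<phi> = rel_power (fst Y) (snd Y) n)"

lemma end_frel_objD:
  assumes "end_frel_obj R X"
  shows "module R (fst X)" "linear_relation R (fst X) (fst X) (snd X)"
  using assms
  by (auto simp: end_frel_obj_def finite_length_module_def artinian_module_def split_beta)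

lemma rel_power_add_obj:
  assumes "end_frel_obj R X"
  shows "rel_power (fst X) (snd X) (m + n) = rel_power (fst X) (snd X) m O rel_power (fst X) (snd X) n"
  using end_frel_objD[OF assms] by (intro rel_power_add linear_relationD(1))

text \<open>The middle factor \<open>\<phi>' O \<psi>'\<close> of the composite is a power of the endorelation of \<open>Y\<close>, which \<open>\<psi>\<close>
  carries over to the same power on \<open>X\<close>; so the exponents add.\<close>

lemma shift_equivalent_trans:
  assumes obj: "end_frel_obj R X" "end_frel_obj R Y" "end_frel_obj R Z"
    and XY: "shift_equivalent R X Y" and YZ: "shift_equivalent R Y Z"
  shows "shift_equivalent R X Z"
proof -
  let ?P = "\<lambda>X. rel_power (fst X) (snd X)"
  obtain \<phi> \<psi> m where 1: "\<phi> \<in> end_hom R X Y" "\<psi> \<in> end_hom R Y X"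
    "\<phi> O \<psi> = ?P X m" "\<psi> O \<phi> = ?P Y m"
    using XY by (auto simp: shift_equivalent_def)
  obtain \<phi>' \<psi>' n where 2: "\<phi>' \<in> end_hom R Y Z" "\<psi>' \<in> end_hom R Z Y"
    "\<phi>' O \<psi>' = ?P Y n" "\<psi>' O \<phi>' = ?P Z n"
    using YZ by (auto simp: shift_equivalent_def)
  have comm: "?P Y n O \<psi> = \<psi> O ?P X n" "?P Y m O \<phi>' = \<phi>' O ?P Z m"
    using end_hom_rel_power[of R "fst Y" "snd Y" "fst X" "snd X" \<psi> n]
      end_hom_rel_power[of R "fst Y" "snd Y" "fst Z" "snd Z" \<phi>' m] obj 1(2) 2(1)
    by simp_all
  have "(\<phi> O \<phi>') O (\<psi>' O \<psi>) = \<phi> O (\<phi>' O \<psi>') O \<psi>" by (simp add: O_assoc)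
  also have "\<dots> = (\<phi> O \<psi>) O ?P X n" by (simp add: 2(3) comm(1) O_assoc)
  also have "\<dots> = ?P X (m + n)" by (simp add: 1(3) rel_power_add_obj[OF obj(1)])
  finally have a: "(\<phi> O \<phi>') O (\<psi>' O \<psi>) = ?P X (m + n)" .
  have "(\<psi>' O \<psi>) O (\<phi> O \<phi>') = \<psi>' O (\<psi> O \<phi>) O \<phi>'" by (simp add: O_assoc)
  also have "\<dots> = (\<psi>' O \<phi>') O ?P Z m" by (simp add: 1(4) comm(2) O_assoc)
  also have "\<dots> = ?P Z (m + n)"
    by (simp add: 2(4) rel_power_add_obj[OF obj(3), symmetric] add.commute)
  finally have b: "(\<psi>' O \<psi>) O (\<phi> O \<phi>') = ?P Z (m + n)" .
  show ?thesis
    unfolding shift_equivalent_def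
    using a b end_hom_comp[OF obj(1,2,3) 1(1) 2(1)] end_hom_comp[OF obj(3,2,1) 2(2) 1(2)]
    by blast
qed

lemma Id_on_end_hom:
  assumes "end_frel_obj R X"
  shows "Id_on (carrier (fst X)) \<in> end_hom R X X"
proof -
  note X = end_frel_objD[OF assms]
  have "snd X \<subseteq> carrier (fst X) \<times> carrier (fst X)"
    using linear_relationD(1)[OF X(1,1,2)] .
  then have "snd X O Id_on (carrier (fst X)) = Id_on (carrier (fst X)) O snd X"
    by blast
  then show ?thesis
    using linear_relation_Id_on[OF X(1)] by (simp add: end_hom_def split_beta)
qed

text \<open>Dividing the \<open>n\<close>-th power formally by the exponent \<open>n\<close> gives the identity.\<close>

lemma szym_class_rel_power:
  assumes obj: "end_frel_obj R X" and \<phi>: "\<phi> \<in> end_hom R X X"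
    and pow: "\<phi> = rel_power (fst X) (snd X) n"
  shows "szym_class R X X \<phi> n = szym_id R X"
proof -
  let ?P = "rel_power (fst X) (snd X)" and ?I = "Id_on (carrier (fst X))"
  have "\<exists>k. ?P (0 + k) O \<phi> = ?P (n + k) O ?I"
    using rel_power_add_obj[OF obj, of 0 n] rel_power_add_obj[OF obj, of n 0] pow
    by (intro exI[of _ 0]) simp
  then have "((\<phi>, n), (?I, 0)) \<in> szym_equiv R X X"
    using \<phi> Id_on_end_hom[OF obj] unfolding szym_equiv_def split_beta by fastforce
  then show ?thesis
    unfolding szym_id_def szym_class_def
    by (rule equiv_class_eq[OF equiv_szym_equiv[OF obj obj]])
qed

text \<open>The isomorphism is \<open>[\<phi>, 0]\<close> with inverse \<open>[\<psi>, n]\<close>: the exponent \<open>n\<close> cancels the \<open>n\<close>-th powers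
  that both composites produce.\<close>

lemma szym_frel_isomorphic_if_shift_equivalent:
  assumes obj: "end_frel_obj R X" "end_frel_obj R Y"
    and eqv: "shift_equivalent R X Y"
  shows "szym_frel_isomorphic R X Y"
proof -
  obtain \<phi> \<psi> n where hom: "\<phi> \<in> end_hom R X Y" "\<psi> \<in> end_hom R Y X"
    and pow: "\<phi> O \<psi> = rel_power (fst X) (snd X) n" "\<psi> O \<phi> = rel_power (fst Y) (snd Y) n"
    using eqv by (auto simp: shift_equivalent_def)
  let ?F = "szym_class R X Y \<phi> 0" and ?G = "szym_class R Y X \<psi> n"
  have "?F \<in> szym_hom R X Y" "?G \<in> szym_hom R Y X"
    using hom by (auto simp: szym_hom_def szym_class_def intro!: quotientI)
  moreover have "szym_comp R X X ?G ?F = szym_id R X"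
    using szym_comp_class[OF obj(1,2,1) hom, of n 0]
      szym_class_rel_power[OF obj(1) end_hom_comp[OF obj(1,2,1) hom] pow(1)] by simp
  moreover have "szym_comp R Y Y ?F ?G = szym_id R Y"
    using szym_comp_class[OF obj(2,1,2) hom(2,1), of 0 n]
      szym_class_rel_power[OF obj(2) end_hom_comp[OF obj(2,1,2) hom(2,1)] pow(2)] by simp
  ultimately show ?thesis
    using obj unfolding szym_frel_isomorphic_def by blast
qed

section \<open>Powers of a linear endorelation\<close>

locale linear_endorelation = module R A
  for R :: "('r, 's) ring_scheme" (structure) and A :: "('r, 'a, 'm) module_scheme" (structure) +
  fixes \<alpha> :: "('a \<times> 'a) set"
  assumes linear: "linear_relation R A A \<alpha>"
begin

abbreviation P :: "nat \<Rightarrow> ('a \<times> 'a) set"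
  where "P \<equiv> rel_power A \<alpha>"

lemma is_module: "module R A"
  by (rule module_axioms)

lemma P_add: "P (m + n) = P m O P n"
  by (rule rel_power_add[OF linear_relationD(1)[OF is_module is_module linear]])

lemma P_linear: "linear_relation R A A (P k)"
proof (induction k)
  case (Suc k)
  then show ?case
    using linear_relation_comp[OF is_module is_module is_module Suc linear] by simp
qed (simp add: linear_relation_Id_on is_module)

lemmas P_subset = linear_relationD(1)[OF is_module is_module P_linear]
  and P_zero = linear_relationD(2)[OF is_module is_module P_linear]
  and P_plus = linear_relationD(3)[OF is_module is_module P_linear]

lemma P_1: "P (Suc 0) = \<alpha>"
  using linear_relationD(1)[OF is_module is_module linear] by auto

lemma P_commute: "\<alpha> O P k = P k O \<alpha>"
  using P_add[of "Suc 0" k] P_1 by simp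

text \<open>Inversion exchanges kernel and multivalued part, and domain and range. This lemma lets statements
  about one of them be transferred to the other.\<close>

lemma P_converse: "rel_power A (\<alpha>\<inverse>) k = (P k)\<inverse>"
proof (induction k)
  case (Suc k)
  then show ?case by (simp flip: converse_relcomp add: P_commute)
qed simp

lemma converse_endorelation: "linear_endorelation R A (\<alpha>\<inverse>)"
  by unfold_locales (rule linear_relation_converse[OF is_module is_module linear])

lemma rel_int_power_Image:
  "range (\<lambda>l::int. rel_int_power A \<alpha> l `` S) = range (\<lambda>k. P k `` S) \<union> range (\<lambda>k. (P k)\<inverse> `` S)"
proof -
  have "rel_int_power A \<alpha> (int k) = P k" for k by (simp add: rel_int_power_def)
  moreover have "rel_int_power A \<alpha> (- int k) = (P k)\<inverse>" for k
    by (cases "k = 0") (auto simp: rel_int_power_def P_converse)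
  ultimately have "range (\<lambda>l::int. rel_int_power A \<alpha> l `` S) \<supseteq>
      range (\<lambda>k. P k `` S) \<union> range (\<lambda>k. (P k)\<inverse> `` S)"
    by (metis (mono_tags, lifting) Un_least image_subsetI rangeI)
  then show ?thesis
    by (auto simp: rel_int_power_def P_converse)
qed

text \<open>The kernel and the multivalued part of \<open>\<alpha>\<^sup>k\<close>.\<close>

abbreviation ker :: "nat \<Rightarrow> 'a set" where "ker k \<equiv> (P k)\<inverse> `` {\<zero>\<^bsub>A\<^esub>}"
abbreviation mul :: "nat \<Rightarrow> 'a set" where "mul k \<equiv> P k `` {\<zero>\<^bsub>A\<^esub>}"

lemma gker_eq: "gker R (A, \<alpha>) = generated_submodule R A (\<Union>k. mul k \<union> ker k)"
proof -
  have "(\<Union>l::int. rel_int_power A \<alpha> l `` {\<zero>\<^bsub>A\<^esub>}) = (\<Union>k. mul k \<union> ker k)"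
    unfolding rel_int_power_Image by blast
  then show ?thesis by (simp add: gker_def)
qed

lemma gim_eq: "gim (A, \<alpha>) = (\<Inter>k. Range (P k) \<inter> Domain (P k))"
proof -
  have "P k `` carrier A = Range (P k)" "(P k)\<inverse> `` carrier A = Domain (P k)" for k
    using P_subset[of k] by blast+
  then show ?thesis
    unfolding gim_def prod.case rel_int_power_Image by auto
qed

lemma submodule_mul: "submodule (mul k) R A" and submodule_ker: "submodule (ker k) R A"
  using submodule_image_linear_relation[OF is_module is_module _ submodule_zero[OF is_module]]
    P_linear linear_relation_converse[OF is_module is_module P_linear]
  by blast+

lemma submodule_gker: "submodule (gker R (A, \<alpha>)) R A"
proof -
  have "(\<Union>k. mul k \<union> ker k) \<subseteq> carrier A" using P_subset by blast
  then show ?thesis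
    unfolding gker_eq generated_submodule_def
    using carrier_is_submodule by (intro submodule_inter) auto
qed

lemma mul_subset_gker: "mul k \<subseteq> gker R (A, \<alpha>)" and ker_subset_gker: "ker k \<subseteq> gker R (A, \<alpha>)"
  unfolding gker_eq generated_submodule_def by blast+

lemma submodule_Range_P: "submodule (Range (P k)) R A"
  and submodule_Domain_P: "submodule (Domain (P k)) R A"
  using submodule_Domain[OF is_module is_module P_linear, of k]
    submodule_Domain[OF is_module is_module linear_relation_converse[OF is_module is_module P_linear], of k]
  by simp_all

lemma submodule_gim: "submodule (gim (A, \<alpha>)) R A"
proof -
  have "gim (A, \<alpha>) = \<Inter>(range (\<lambda>k. Range (P k)) \<union> range (\<lambda>k. Domain (P k)))"
    by (auto simp: gim_eq)
  also have "submodule \<dots> R A"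
    using submodule_Range_P submodule_Domain_P by (intro submodule_inter) auto
  finally show ?thesis .
qed

text \<open>The shift equivalence is \<open>P N O e\<close> and \<open>e\<inverse> O P N\<close>. The condition \<open>absorb\<close> makes their composite on \<open>A\<close>
  equal to \<open>P (N + N)\<close>; the composite on \<open>B\<close> is \<open>e\<inverse> O P (N + N) O e\<close>, which is a power of the compressed
  relation by \<open>absorb_inner\<close>; the other two conditions make both relations morphisms. All four say
  that \<open>e O e\<inverse>\<close> can be dropped between two factors.\<close>

lemma compression_shift_equivalent:
  fixes B :: "('r, 'b, 'n) module_scheme"
  assumes B: "module R B" and e: "linear_relation R A B e"
    and retr: "e\<inverse> O e = Id_on (carrier B)"
    and absorb: "P N O e O e\<inverse> O P N = P N O P N"
    and absorb_left: "P N O e O e\<inverse> O \<alpha> O e = P N O \<alpha> O e"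
    and absorb_right: "e\<inverse> O \<alpha> O e O e\<inverse> O P N = e\<inverse> O \<alpha> O P N"
    and absorb_inner: "\<And>k. e\<inverse> O P k O e O e\<inverse> O \<alpha> O e = e\<inverse> O P k O \<alpha> O e"
  shows "shift_equivalent R (A, \<alpha>) (B, e\<inverse> O \<alpha> O e)"
proof -
  let ?\<beta> = "e\<inverse> O \<alpha> O e" and ?\<phi> = "P N O e" and ?\<psi> = "e\<inverse> O P N"
  have e_sub: "e \<subseteq> carrier A \<times> carrier B"
    using linear_relationD(1)[OF is_module B e] .
  have e': "linear_relation R B A (e\<inverse>)"
    using linear_relation_converse[OF is_module B e] .
  have pow: "rel_power B ?\<beta> k = e\<inverse> O P k O e" for k
  proof (induction k)
    case 0
    have "e\<inverse> O Id_on (carrier A) O e = e\<inverse> O e" using e_sub by blast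
    then show ?case by (simp add: retr)
  next
    case (Suc k)
    then show ?case using absorb_inner[of k] by (simp add: O_assoc)
  qed
  have "?\<phi> \<in> end_hom R (A, \<alpha>) (B, ?\<beta>)"
    using linear_relation_comp[OF is_module is_module B P_linear e] absorb_left
    by (simp add: end_hom_def O_assoc) (simp add: P_commute flip: O_assoc)
  moreover have "?\<psi> \<in> end_hom R (B, ?\<beta>) (A, \<alpha>)"
    using linear_relation_comp[OF B is_module is_module e' P_linear] absorb_right
    by (simp add: end_hom_def O_assoc P_commute)
  moreover have "?\<phi> O ?\<psi> = P (N + N)" using absorb by (simp add: O_assoc P_add)
  moreover have "?\<psi> O ?\<phi> = rel_power B ?\<beta> (N + N)" by (simp add: pow P_add O_assoc)
  ultimately show ?thesis unfolding shift_equivalent_def fst_conv snd_conv by blast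
qed

end

section \<open>Stabilisation in modules of finite length\<close>

locale finite_length_endorelation = linear_endorelation R A \<alpha> + finite_length_module R A
  for R :: "('r, 's) ring_scheme" (structure) and A :: "('r, 'a, 'm) module_scheme" (structure)
    and \<alpha> :: "('a \<times> 'a) set"
begin

lemma converse_finite_length: "finite_length_endorelation R A (\<alpha>\<inverse>)"
  by (intro finite_length_endorelation.intro converse_endorelation finite_length_module_axioms)

text \<open>The multivalued parts grow because a path that starts in \<open>0\<close> can be prolonged backwards by a step
  from \<open>0\<close> to \<open>0\<close>.\<close>

lemma mul_stable: "\<exists>N. \<forall>n\<ge>N. \<forall>k. mul k \<subseteq> mul n"
proof -
  have step: "mul k \<subseteq> mul (Suc k)" for k
    using P_zero[of "Suc 0"] unfolding rel_power.simps(2)[of _ _ k] P_commute[symmetric] P_1 by blast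
  obtain N where N: "\<forall>n\<ge>N. mul n = mul N"
    using ascending_chain[of mul, OF submodule_mul step] by blast
  have "mul k \<subseteq> mul n" if "n \<ge> N" for n k
  proof -
    have "mul k \<subseteq> mul (max N k)" using lift_Suc_mono_le[of mul, OF step] by simp
    also have "\<dots> = mul n" using N that by (metis max.cobounded1)
    finally show ?thesis .
  qed
  then show ?thesis by blast
qed

lemma Range_stable: "\<exists>N. \<forall>n\<ge>N. \<forall>k. Range (P n) \<subseteq> Range (P k)"
proof -
  have step: "Range (P (Suc k)) \<subseteq> Range (P k)" for k
    unfolding rel_power.simps(2) P_commute[symmetric] by blast
  obtain N where N: "\<forall>n\<ge>N. Range (P n) = Range (P N)"
    using descending_chain[of "\<lambda>k. Range (P k)", OF submodule_Range_P step] by blast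
  have "Range (P n) \<subseteq> Range (P k)" if "n \<ge> N" for n k
  proof -
    have "Range (P n) = Range (P (max N k))" using N that by (metis max.cobounded1)
    also have "\<dots> \<subseteq> Range (P k)"
      using lift_Suc_antimono_le[of "\<lambda>k. Range (P k)", OF step] by simp
    finally show ?thesis .
  qed
  then show ?thesis by blast
qed

text \<open>Kernels and multivalued parts are stationary from some common \<open>N\<close> on, so the submodule
  \<open>ker N + mul N\<close> already contains all of them.\<close>

lemma gker_stable:
  "\<exists>N. \<forall>u\<in>gker R (A, \<alpha>). \<exists>z\<in>mul N. \<exists>w\<in>ker N. u = w \<oplus>\<^bsub>A\<^esub> z"
proof -
  interpret inv: finite_length_endorelation R A "\<alpha>\<inverse>" by (rule converse_finite_length)
  obtain N where N: "\<forall>n\<ge>N. \<forall>k. mul k \<subseteq> mul n" using mul_stable by blast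
  obtain N' where N': "\<forall>n\<ge>N'. \<forall>k. ker k \<subseteq> ker n" using inv.mul_stable unfolding P_converse by blast
  let ?n = "max N N'"
  let ?S = "{w \<oplus>\<^bsub>A\<^esub> z |w z. w \<in> ker ?n \<and> z \<in> mul ?n}"
  have "mul k \<subseteq> ?S" for k
  proof
    fix z assume "z \<in> mul k"
    then have z: "z \<in> mul ?n" using N by (meson max.cobounded1 subsetD)
    then have "z = \<zero>\<^bsub>A\<^esub> \<oplus>\<^bsub>A\<^esub> z"
      using M.l_zero[of z] submoduleE(1)[OF submodule_mul, of ?n] by force
    then show "z \<in> ?S" using z submodule_zero_mem[OF submodule_ker] by blast
  qed
  moreover have "ker k \<subseteq> ?S" for k
  proof
    fix w assume "w \<in> ker k"
    then have w: "w \<in> ker ?n" using N' by (meson max.cobounded2 subsetD)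
    then have "w = w \<oplus>\<^bsub>A\<^esub> \<zero>\<^bsub>A\<^esub>"
      using M.r_zero[of w] submoduleE(1)[OF submodule_ker, of ?n] by force
    then show "w \<in> ?S" using w submodule_zero_mem[OF submodule_mul] by blast
  qed
  ultimately have "gker R (A, \<alpha>) \<subseteq> ?S"
    unfolding gker_eq generated_submodule_def
    using submodule_set_add[OF submodule_ker[of ?n] submodule_mul[of ?n]] by blast
  then show ?thesis by blast
qed

lemma gim_stable: "\<exists>N. gim (A, \<alpha>) = Range (P N) \<inter> Domain (P N)"
proof -
  interpret inv: finite_length_endorelation R A "\<alpha>\<inverse>" by (rule converse_finite_length)
  obtain N where N: "\<forall>n\<ge>N. \<forall>k. Range (P n) \<subseteq> Range (P k)" using Range_stable by blast
  obtain N' where N': "\<forall>n\<ge>N'. \<forall>k. Domain (P n) \<subseteq> Domain (P k)"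
    using inv.Range_stable unfolding P_converse Range_converse by blast
  have "gim (A, \<alpha>) = Range (P (max N N')) \<inter> Domain (P (max N N'))"
    unfolding gim_eq
    using N[rule_format, of "max N N'"] N'[rule_format, of "max N N'"] by (simp, blast)
  then show ?thesis by blast
qed

end

section \<open>Passing to the quotient by the generalised kernel\<close>

text \<open>For a submodule \<open>H\<close> this is congruence modulo \<open>H\<close>, written as translation by elements of \<open>H\<close>: a
  jump in the sense of the introduction.\<close>

definition coset_rel :: "('r, 'a, 'm) module_scheme \<Rightarrow> 'a set \<Rightarrow> ('a \<times> 'a) set"
  where "coset_rel A H = {(x, h \<oplus>\<^bsub>A\<^esub> x) |x h. x \<in> carrier A \<and> h \<in> H}"

definition quotient_map :: "('r, 'a, 'm) module_scheme \<Rightarrow> 'a set \<Rightarrow> ('a \<times> 'a set) set"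
  where "quotient_map A H = {(x, H +>\<^bsub>A\<^esub> x) |x. x \<in> carrier A}"

context
  fixes R :: "('r, 's) ring_scheme" and A :: "('r, 'a, 'm) module_scheme" and H :: "'a set"
  assumes A: "module R A" and H: "submodule H R A"
begin

interpretation module R A by (rule A)

interpretation H: abelian_subgroup H A
  using submodule.axioms(1)[OF H] M.abelian_group_axioms
  by (intro abelian_subgroupI3 additive_subgroup.intro)

lemma same_coset_iff:
  assumes "x \<in> carrier A" "y \<in> carrier A"
  shows "H +>\<^bsub>A\<^esub> x = H +>\<^bsub>A\<^esub> y \<longleftrightarrow> (\<exists>h\<in>H. y = h \<oplus>\<^bsub>A\<^esub> x)"
proof -
  have "H +>\<^bsub>A\<^esub> x = H +>\<^bsub>A\<^esub> y \<longleftrightarrow> y \<in> H +>\<^bsub>A\<^esub> x"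
    using H.a_repr_independence' H.a_repr_independenceD assms by blast
  then show ?thesis unfolding a_r_coset_def' by blast
qed

lemma quotient_map_kernel_pair: "quotient_map A H O (quotient_map A H)\<inverse> = coset_rel A H"
proof -
  have "(x, y) \<in> quotient_map A H O (quotient_map A H)\<inverse> \<longleftrightarrow>
      x \<in> carrier A \<and> y \<in> carrier A \<and> H +>\<^bsub>A\<^esub> x = H +>\<^bsub>A\<^esub> y" for x y
    unfolding quotient_map_def by blast
  moreover have "h \<oplus>\<^bsub>A\<^esub> x \<in> carrier A" if "x \<in> carrier A" "h \<in> H" for x h
    using that submoduleE(1)[OF H] by blast
  then have "(x, y) \<in> coset_rel A H \<longleftrightarrow>
      x \<in> carrier A \<and> y \<in> carrier A \<and> (\<exists>h\<in>H. y = h \<oplus>\<^bsub>A\<^esub> x)" for x y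
    unfolding coset_rel_def by blast
  ultimately have "(x, y) \<in> quotient_map A H O (quotient_map A H)\<inverse> \<longleftrightarrow>
      (x, y) \<in> coset_rel A H" for x y
    using same_coset_iff[of x y] by (simp cong: conj_cong)
  then show ?thesis by (intro equalityI subrelI) simp_all
qed

lemma quotient_map_section:
  "(quotient_map A H)\<inverse> O quotient_map A H = Id_on (carrier (quotient_module A H))"
proof -
  have "carrier (quotient_module A H) = Range (quotient_map A H)"
    unfolding quotient_module_simps A_RCOSETS_def' quotient_map_def by blast
  then show ?thesis unfolding quotient_map_def by auto
qed

lemma coset_rel_quotient_map:
  assumes "L \<subseteq> H"
  shows "coset_rel A L O quotient_map A H \<subseteq> quotient_map A H"
proof -
  have "coset_rel A L O quotient_map A H \<subseteq> coset_rel A H O quotient_map A H"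
    unfolding coset_rel_def using assms by blast
  also have "\<dots> = quotient_map A H O Id_on (carrier (quotient_module A H))"
    unfolding quotient_map_section[symmetric] quotient_map_kernel_pair[symmetric]
    by (simp only: O_assoc)
  also have "\<dots> \<subseteq> quotient_map A H" by blast
  finally show ?thesis .
qed

lemma linear_relation_quotient_map: "linear_relation R A (quotient_module A H) (quotient_map A H)"
  unfolding linear_relation_iff[OF A module_quotient_module[OF A H]]
proof (intro conjI allI impI)
  show "quotient_map A H \<subseteq> carrier A \<times> carrier (quotient_module A H)"
    by (auto simp: quotient_map_def A_RCOSETS_def')
  show "(\<zero>\<^bsub>A\<^esub>, \<zero>\<^bsub>quotient_module A H\<^esub>) \<in> quotient_map A H"
    using M.a_coset_add_zero[OF submoduleE(1)[OF H]] by (auto simp: quotient_map_def)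
next
  fix x X y Y assume "(x, X) \<in> quotient_map A H" "(y, Y) \<in> quotient_map A H"
  then show "(x \<oplus>\<^bsub>A\<^esub> y, X \<oplus>\<^bsub>quotient_module A H\<^esub> Y) \<in> quotient_map A H"
    by (auto simp: quotient_map_def H.a_rcos_sum)
next
  fix r x X assume "r \<in> carrier R" "(x, X) \<in> quotient_map A H"
  then show "(r \<odot>\<^bsub>A\<^esub> x, r \<odot>\<^bsub>quotient_module A H\<^esub> X) \<in> quotient_map A H"
    using quotient_module_smult[OF A H]
    by (auto simp: quotient_map_def simp del: quotient_module_simps)
qed

end

text \<open>A chain of submodules of the quotient is determined by its preimages in \<open>A\<close>, since taking the
  preimage and then the image gives back the submodule.\<close>

lemma finite_length_quotient_module:
  fixes R :: "('r, 's) ring_scheme" and A :: "('r, 'a, 'm) module_scheme"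
  assumes fl: "finite_length_module R A" and H: "submodule H R A"
  shows "finite_length_module R (quotient_module A H)"
proof -
  interpret finite_length_module R A by fact
  let ?Q = "quotient_module A H" and ?\<pi> = "quotient_map A H"
  note A = module_axioms
  note Q = module_quotient_module[OF A H]
  note \<pi> = linear_relation_converse[OF A Q linear_relation_quotient_map[OF A H]]
  have pull: "submodule (?\<pi>\<inverse> `` L) R A" if "submodule L R ?Q" for L
    by (rule submodule_image_linear_relation[OF Q A \<pi> that])
  have push: "?\<pi> `` (?\<pi>\<inverse> `` L) = L" if "submodule L R ?Q" for L
  proof -
    have "?\<pi> `` (?\<pi>\<inverse> `` L) = (?\<pi>\<inverse> O ?\<pi>) `` L" by blast
    also have "\<dots> = L"
      unfolding quotient_map_section[OF A H] using module.submoduleE(1)[OF Q that] by blast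
    finally show ?thesis .
  qed
  have stable: "\<exists>k. \<forall>n\<ge>k. L n = L k"
    if "\<And>n::nat. submodule (L n) R ?Q" "\<exists>k. \<forall>n\<ge>k. ?\<pi>\<inverse> `` L n = ?\<pi>\<inverse> `` L k"
    for L :: "nat \<Rightarrow> 'a set set"
    using that push by metis
  show ?thesis
  proof (intro finite_length_module.intro noetherian_module.intro artinian_module.intro Q
      noetherian_module_axioms.intro artinian_module_axioms.intro)
    fix L :: "nat \<Rightarrow> 'a set set"
    assume L: "\<And>n. submodule (L n) R ?Q"
    show "\<exists>k. \<forall>n\<ge>k. L n = L k" if "\<And>n. L n \<subseteq> L (Suc n)"
      by (rule stable[OF L]) (intro ascending_chain pull L Image_mono that order_refl)
    show "\<exists>k. \<forall>n\<ge>k. L n = L k" if "\<And>n. L (Suc n) \<subseteq> L n"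
      by (rule stable[OF L]) (intro descending_chain pull L Image_mono that order_refl)
  qed
qed

lemma gker_proj_eq: "gker_proj R X = quotient_map (fst X) (gker R X)"
  by (simp add: gker_proj_def quotient_map_def)

text \<open>A jump by \<open>z\<close> with \<open>(0, z) \<in> P N\<close> after \<open>N\<close> steps is absorbed by adding to those steps a path
  from \<open>0\<close> to \<open>z\<close>.\<close>

lemma (in linear_endorelation) P_coset_mul: "P N O coset_rel A (mul N) \<subseteq> P N"
proof
  fix p assume "p \<in> P N O coset_rel A (mul N)"
  then obtain x m z where p: "p = (x, z \<oplus>\<^bsub>A\<^esub> m)" "(x, m) \<in> P N" "(\<zero>\<^bsub>A\<^esub>, z) \<in> P N"
    by (auto simp: coset_rel_def)
  then show "p \<in> P N"
    using P_plus[OF p(3,2)] P_subset[of N] by auto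
qed

text \<open>Dually, a jump by \<open>w\<close> with \<open>(w, 0) \<in> P N\<close> before \<open>N\<close> steps is absorbed by subtracting a path from \<open>w\<close>
  to \<open>0\<close>.\<close>

lemma (in linear_endorelation) coset_ker_P: "coset_rel A (ker N) O P N \<subseteq> P N"
proof
  fix p assume "p \<in> coset_rel A (ker N) O P N"
  then obtain x y w where p: "p = (x, y)" "(w \<oplus>\<^bsub>A\<^esub> x, y) \<in> P N" "(w, \<zero>\<^bsub>A\<^esub>) \<in> P N"
    and x: "x \<in> carrier A"
    by (auto simp: coset_rel_def)
  have c: "w \<in> carrier A" "y \<in> carrier A" using p P_subset[of N] by auto
  have "(\<ominus>\<^bsub>A\<^esub> w, \<zero>\<^bsub>A\<^esub>) \<in> P N"
    using submoduleE(3)[OF submodule_ker, of w N] p(3) by auto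
  from P_plus[OF this p(2)] show "p \<in> P N"
    using p(1) x c by (simp add: M.r_neg1)
qed

text \<open>Every \<open>z \<in> mul N\<close> has a predecessor under \<open>P k\<close> that is again in \<open>mul N\<close>: prolong the path of
  length \<open>N\<close> from \<open>0\<close> to \<open>z\<close> by \<open>k\<close> initial steps from \<open>0\<close> to \<open>0\<close>, and take the point that is \<open>k\<close> steps
  before \<open>z\<close>. Adding the rest of this path moves the jump in front of the \<open>k\<close> steps.\<close>

lemma (in linear_endorelation) coset_mul_slide:
  "P k O coset_rel A (mul N) \<subseteq> coset_rel A (mul N) O P k"
proof
  fix p assume "p \<in> P k O coset_rel A (mul N)"
  then obtain x m z where p: "p = (x, z \<oplus>\<^bsub>A\<^esub> m)" "(x, m) \<in> P k" "(\<zero>\<^bsub>A\<^esub>, z) \<in> P N"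
    by (auto simp: coset_rel_def)
  have "(\<zero>\<^bsub>A\<^esub>, z) \<in> P k O P N" using p(3) P_zero[of k] by blast
  then have "(\<zero>\<^bsub>A\<^esub>, z) \<in> P N O P k" by (metis P_add add.commute)
  then obtain z' where z': "(\<zero>\<^bsub>A\<^esub>, z') \<in> P N" "(z', z) \<in> P k" by blast
  have "(x, z' \<oplus>\<^bsub>A\<^esub> x) \<in> coset_rel A (mul N)"
    using z'(1) p(2) P_subset[of k] by (auto simp: coset_rel_def)
  then show "p \<in> coset_rel A (mul N) O P k"
    using P_plus[OF z'(2) p(2)] p(1) by blast
qed

text \<open>Every \<open>w \<in> ker N\<close> has a successor under \<open>P k\<close> that is again in \<open>ker N\<close>; subtracting the path
  between them moves the jump behind the \<open>k\<close> steps.\<close>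

lemma (in linear_endorelation) coset_ker_slide:
  "coset_rel A (ker N) O P k \<subseteq> P k O coset_rel A (ker N)"
proof
  fix p assume "p \<in> coset_rel A (ker N) O P k"
  then obtain x y w where p: "p = (x, y)" "(w \<oplus>\<^bsub>A\<^esub> x, y) \<in> P k" "(w, \<zero>\<^bsub>A\<^esub>) \<in> P N"
    and x: "x \<in> carrier A"
    by (auto simp: coset_rel_def)
  have "(w, \<zero>\<^bsub>A\<^esub>) \<in> P N O P k" using p(3) P_zero[of k] by blast
  then have "(w, \<zero>\<^bsub>A\<^esub>) \<in> P k O P N" by (metis P_add add.commute)
  then obtain w' where w': "(w, w') \<in> P k" "(w', \<zero>\<^bsub>A\<^esub>) \<in> P N" by blast
  have c: "w \<in> carrier A" "y \<in> carrier A" "w' \<in> carrier A"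
    using p w' P_subset[of N] P_subset[of k] by auto
  have "(\<ominus>\<^bsub>A\<^esub> w, \<ominus>\<^bsub>A\<^esub> w') \<in> P k"
    using linear_relationD(4)[OF is_module is_module P_linear _ w'(1), of "\<ominus>\<^bsub>R\<^esub> \<one>\<^bsub>R\<^esub>"] c
    by (simp add: smult_l_minus)
  from P_plus[OF this p(2)] have "(x, \<ominus>\<^bsub>A\<^esub> w' \<oplus>\<^bsub>A\<^esub> y) \<in> P k"
    using x c by (simp add: M.r_neg1)
  moreover have "(\<ominus>\<^bsub>A\<^esub> w' \<oplus>\<^bsub>A\<^esub> y, y) \<in> coset_rel A (ker N)"
    using w'(2) c unfolding coset_rel_def
    by (intro CollectI exI[of _ "\<ominus>\<^bsub>A\<^esub> w' \<oplus>\<^bsub>A\<^esub> y"] exI[of _ w']) (auto simp: M.r_neg2)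
  ultimately show "p \<in> P k O coset_rel A (ker N)" using p(1) by blast
qed

context finite_length_endorelation
begin

lemma LM_shift_equivalent: "shift_equivalent R (A, \<alpha>) (LM_obj R (A, \<alpha>))"
proof -
  let ?K = "gker R (A, \<alpha>)"
  let ?\<pi> = "quotient_map A ?K" and ?\<kappa> = "coset_rel A ?K"
  note sub = is_module submodule_gker
  obtain N where N: "\<forall>u\<in>?K. \<exists>z\<in>mul N. \<exists>w\<in>ker N. u = w \<oplus>\<^bsub>A\<^esub> z"
    using gker_stable by blast
  let ?\<zeta> = "coset_rel A (mul N)" and ?\<omega> = "coset_rel A (ker N)"
  have \<kappa>: "?\<pi> O ?\<pi>\<inverse> = ?\<kappa>" by (rule quotient_map_kernel_pair[OF sub])
  have \<kappa>_factor: "?\<kappa> \<subseteq> ?\<zeta> O ?\<omega>"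
  proof
    fix p assume "p \<in> ?\<kappa>"
    then obtain x u where p: "p = (x, u \<oplus>\<^bsub>A\<^esub> x)" and x: "x \<in> carrier A" and "u \<in> ?K"
      by (auto simp: coset_rel_def)
    then obtain z w where zw: "z \<in> mul N" "w \<in> ker N" "u = w \<oplus>\<^bsub>A\<^esub> z" using N by blast
    have c: "z \<in> carrier A" "w \<in> carrier A" using zw(1,2) P_subset[of N] by blast+
    have "(x, z \<oplus>\<^bsub>A\<^esub> x) \<in> ?\<zeta>" using x zw(1) unfolding coset_rel_def by blast
    moreover have "(z \<oplus>\<^bsub>A\<^esub> x, w \<oplus>\<^bsub>A\<^esub> (z \<oplus>\<^bsub>A\<^esub> x)) \<in> ?\<omega>"
      using x zw(2) c unfolding coset_rel_def by blast
    ultimately show "p \<in> ?\<zeta> O ?\<omega>" using p x c zw(3) by (auto simp: M.a_assoc)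
  qed
  have \<omega>\<pi>: "?\<omega> O ?\<pi> \<subseteq> ?\<pi>"
    by (rule coset_rel_quotient_map[OF sub ker_subset_gker])
  have \<pi>\<zeta>: "?\<pi>\<inverse> O ?\<zeta> \<subseteq> ?\<pi>\<inverse>"
  proof -
    have "?\<zeta> \<subseteq> ?\<kappa>" unfolding coset_rel_def using mul_subset_gker by blast
    then have "?\<pi>\<inverse> O ?\<zeta> \<subseteq> (?\<pi>\<inverse> O ?\<pi>) O ?\<pi>\<inverse>" unfolding \<kappa>[symmetric] by blast
    then show ?thesis unfolding quotient_map_section[OF sub] by blast
  qed
  \<comment> \<open>A jump is the product of a jump in \<open>mul N\<close>, which the factor before it absorbs, and of a jump
    in \<open>ker N\<close>, which the factor after it absorbs.\<close>
  have drop: "S O ?\<pi> O ?\<pi>\<inverse> O T = S O T"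
    if S: "S O ?\<zeta> \<subseteq> S" and T: "?\<omega> O T \<subseteq> T" and "Range S \<subseteq> carrier A"
    for S :: "('x \<times> 'a) set" and T :: "('a \<times> 'y) set"
  proof
    have "S O ?\<pi> O ?\<pi>\<inverse> O T = S O ?\<kappa> O T" by (simp only: \<kappa>[symmetric] O_assoc)
    also have "\<dots> \<subseteq> S O (?\<zeta> O ?\<omega>) O T" by (intro relcomp_mono order_refl \<kappa>_factor)
    also have "\<dots> = (S O ?\<zeta>) O (?\<omega> O T)" by (simp only: O_assoc)
    also have "\<dots> \<subseteq> S O T" by (intro relcomp_mono S T)
    finally show "S O ?\<pi> O ?\<pi>\<inverse> O T \<subseteq> S O T" .
    show "S O T \<subseteq> S O ?\<pi> O ?\<pi>\<inverse> O T"
      using that(3) unfolding quotient_map_def by blast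
  qed
  \<comment> \<open>Here the jump slides along the powers until the projection absorbs it.\<close>
  have left: "(?\<pi>\<inverse> O P k) O ?\<zeta> \<subseteq> ?\<pi>\<inverse> O P k" "Range (?\<pi>\<inverse> O P k) \<subseteq> carrier A" for k
  proof -
    have "(?\<pi>\<inverse> O P k) O ?\<zeta> \<subseteq> (?\<pi>\<inverse> O ?\<zeta>) O P k"
      using relcomp_mono[OF order_refl coset_mul_slide[of k N]] by (simp only: O_assoc)
    also have "\<dots> \<subseteq> ?\<pi>\<inverse> O P k" by (intro relcomp_mono \<pi>\<zeta> order_refl)
    finally show "(?\<pi>\<inverse> O P k) O ?\<zeta> \<subseteq> ?\<pi>\<inverse> O P k" .
    show "Range (?\<pi>\<inverse> O P k) \<subseteq> carrier A" using P_subset[of k] by blast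
  qed
  have right: "?\<omega> O P k O ?\<pi> \<subseteq> P k O ?\<pi>" for k
  proof -
    have "?\<omega> O P k O ?\<pi> \<subseteq> (P k O ?\<omega>) O ?\<pi>"
      using relcomp_mono[OF coset_ker_slide[of N k] order_refl] by (simp only: O_assoc)
    also have "\<dots> \<subseteq> P k O ?\<pi>" unfolding O_assoc by (intro relcomp_mono \<omega>\<pi> order_refl)
    finally show ?thesis .
  qed
  have ran: "Range (P N) \<subseteq> carrier A" using P_subset[of N] by blast
  note left1 = left[of "Suc 0", unfolded P_1] and right1 = right[of "Suc 0", unfolded P_1]
  have "shift_equivalent R (A, \<alpha>) (quotient_module A ?K, ?\<pi>\<inverse> O \<alpha> O ?\<pi>)"
    by (rule compression_shift_equivalent[OF module_quotient_module[OF sub]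
          linear_relation_quotient_map[OF sub] quotient_map_section[OF sub]
          drop[OF P_coset_mul coset_ker_P ran] drop[OF P_coset_mul right1 ran]
          drop[OF left1(1) coset_ker_P left1(2), unfolded O_assoc]
          drop[OF left(1) right1 left(2), unfolded O_assoc]])
  then show ?thesis by (simp add: LM_obj_def LM_mor_def gker_proj_eq)
qed

end

section \<open>Passing to the generalised image\<close>

lemma submodule_trans:
  assumes A: "module R A" and H: "submodule H R A" and L: "submodule L R (A\<lparr>carrier := H\<rparr>)"
  shows "submodule L R A"
proof -
  interpret module R A by fact
  interpret H: module R "A\<lparr>carrier := H\<rparr>" by (rule submodule.submodule_is_module[OF H A])
  show ?thesis
    using H.submoduleE(1)[OF L] H.submodule_zero_mem[OF L] H.submoduleE(4,5)[OF L]
      submoduleE(1)[OF H]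
    by (intro submodule_if_closed) auto
qed

lemma finite_length_submodule:
  assumes fl: "finite_length_module R A" and H: "submodule H R A"
  shows "finite_length_module R (A\<lparr>carrier := H\<rparr>)"
proof -
  interpret finite_length_module R A by fact
  note sub = submodule.submodule_is_module[OF H module_axioms]
  note trans = submodule_trans[OF module_axioms H]
  show ?thesis
    by (intro finite_length_module.intro noetherian_module.intro artinian_module.intro sub
      noetherian_module_axioms.intro artinian_module_axioms.intro ascending_chain descending_chain
      trans)
qed

lemma linear_relation_Id_on_submodule:
  assumes A: "module R A" and H: "submodule H R A"
  shows "linear_relation R A (A\<lparr>carrier := H\<rparr>) (Id_on H)"
proof -
  interpret module R A by fact
  show ?thesis
    unfolding linear_relation_iff[OF A submodule.submodule_is_module[OF H A]]
    using submoduleE(1,4,5)[OF H] submodule_zero_mem[OF H] by auto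
qed

lemma relcomp_through_Id_on:
  assumes "\<And>x m y. (x, m) \<in> S \<Longrightarrow> (m, y) \<in> T \<Longrightarrow> m \<in> G"
  shows "S O Id_on G O (Id_on G)\<inverse> O T = S O T"
proof (intro equalityI subrelI)
  fix x y assume "(x, y) \<in> S O T"
  then obtain m where "(x, m) \<in> S" "(m, y) \<in> T" by blast
  with assms show "(x, y) \<in> S O Id_on G O (Id_on G)\<inverse> O T" by blast
qed auto

lemma gim_incl_eq: "gim_incl X = Id_on (gim X)"
  by (auto simp: gim_incl_def)

lemma (in finite_length_endorelation) LE_shift_equivalent:
  "shift_equivalent R (A, \<alpha>) (LE_obj (A, \<alpha>))"
proof -
  let ?G = "gim (A, \<alpha>)"
  obtain N where N: "?G = Range (P N) \<inter> Domain (P N)" using gim_stable by blast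
  \<comment> \<open>A path that starts in \<open>gim\<close> has an arbitrarily long history at every point, and one that ends
    in \<open>gim\<close> can be continued for arbitrarily many steps; so a path between two points of \<open>gim\<close> stays in \<open>gim\<close>.\<close>
  have push: "m \<in> Range (P N)" if "x \<in> ?G" "(x, m) \<in> P k" for x m k
  proof -
    have "m \<in> Range (P N O P k)" using that N by blast
    also have "P N O P k = P k O P N" by (metis P_add add.commute)
    finally show ?thesis by blast
  qed
  have pull: "m \<in> Domain (P N)" if "y \<in> ?G" "(m, y) \<in> P k" for y m k
  proof -
    have "m \<in> Domain (P k O P N)" using that N by blast
    also have "P k O P N = P N O P k" by (metis P_add add.commute)
    finally show ?thesis by blast
  qed
  note push1 = push[of _ _ "Suc 0", unfolded P_1] and pull1 = pull[of _ _ "Suc 0", unfolded P_1]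
  have "shift_equivalent R (A, \<alpha>)
    (A\<lparr>carrier := ?G\<rparr>, (Id_on ?G)\<inverse> O \<alpha> O Id_on ?G)"
  proof (rule compression_shift_equivalent)
    show "module R (A\<lparr>carrier := ?G\<rparr>)"
      by (rule submodule.submodule_is_module[OF submodule_gim is_module])
    show "linear_relation R A (A\<lparr>carrier := ?G\<rparr>) (Id_on ?G)"
      by (rule linear_relation_Id_on_submodule[OF is_module submodule_gim])
    show "(Id_on ?G)\<inverse> O Id_on ?G = Id_on (carrier (A\<lparr>carrier := ?G\<rparr>))" by auto
    show "P N O Id_on ?G O (Id_on ?G)\<inverse> O P N = P N O P N"
      by (rule relcomp_through_Id_on) (unfold N, blast)
    show "P N O Id_on ?G O (Id_on ?G)\<inverse> O \<alpha> O Id_on ?G = P N O \<alpha> O Id_on ?G"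
    proof (rule relcomp_through_Id_on)
      fix x m y assume "(x, m) \<in> P N" "(m, y) \<in> \<alpha> O Id_on ?G"
      then show "m \<in> ?G" using pull1[of y m] unfolding N by auto
    qed
    have "((Id_on ?G)\<inverse> O \<alpha>) O Id_on ?G O (Id_on ?G)\<inverse> O P N = ((Id_on ?G)\<inverse> O \<alpha>) O P N"
    proof (rule relcomp_through_Id_on)
      fix x m y assume "(x, m) \<in> (Id_on ?G)\<inverse> O \<alpha>" "(m, y) \<in> P N"
      then show "m \<in> ?G" using push1[of x m] unfolding N by auto
    qed
    then show "(Id_on ?G)\<inverse> O \<alpha> O Id_on ?G O (Id_on ?G)\<inverse> O P N = (Id_on ?G)\<inverse> O \<alpha> O P N"
      by (simp only: O_assoc)
    show "(Id_on ?G)\<inverse> O P k O Id_on ?G O (Id_on ?G)\<inverse> O \<alpha> O Id_on ?G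
        = (Id_on ?G)\<inverse> O P k O \<alpha> O Id_on ?G" for k
    proof -
      have "((Id_on ?G)\<inverse> O P k) O Id_on ?G O (Id_on ?G)\<inverse> O \<alpha> O Id_on ?G
          = ((Id_on ?G)\<inverse> O P k) O \<alpha> O Id_on ?G"
      proof (rule relcomp_through_Id_on)
        fix x m y assume "(x, m) \<in> (Id_on ?G)\<inverse> O P k" "(m, y) \<in> \<alpha> O Id_on ?G"
        then show "m \<in> ?G" using push[of x m k] pull1[of y m] unfolding N by auto
      qed
      then show ?thesis by (simp only: O_assoc)
    qed
  qed
  then show ?thesis by (simp add: LE_obj_def LE_mor_def gim_incl_eq)
qed

section \<open>The Leray functor\<close>

lemma end_frel_obj_iff:
  "end_frel_obj R (A, \<alpha>) \<longleftrightarrow> finite_length_endorelation R A \<alpha>"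
  unfolding end_frel_obj_def finite_length_endorelation_def linear_endorelation_def
    linear_endorelation_axioms_def finite_length_module_def artinian_module_def prod.case
  by blast

lemma (in linear_endorelation) linear_relation_compression:
  assumes B: "module R B" and e: "linear_relation R A B e"
  shows "linear_relation R B B (e\<inverse> O \<alpha> O e)"
  using linear_relation_converse[OF is_module B e] linear e is_module B
  by (blast intro: linear_relation_comp)

lemma (in finite_length_endorelation) end_frel_obj_LM: "end_frel_obj R (LM_obj R (A, \<alpha>))"
proof -
  note sub = is_module submodule_gker
  show ?thesis
    using finite_length_quotient_module[OF finite_length_module_axioms submodule_gker]
      linear_relation_compression[OF module_quotient_module[OF sub] linear_relation_quotient_map[OF sub]]
    by (simp add: end_frel_obj_def LM_obj_def LM_mor_def gker_proj_eq)
qed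

lemma (in finite_length_endorelation) end_frel_obj_LE: "end_frel_obj R (LE_obj (A, \<alpha>))"
  using finite_length_submodule[OF finite_length_module_axioms submodule_gim]
    linear_relation_compression[OF submodule.submodule_is_module[OF submodule_gim is_module]
      linear_relation_Id_on_submodule[OF is_module submodule_gim]]
  by (simp add: end_frel_obj_def LE_obj_def LE_mor_def gim_incl_eq)

theorem theorem2p1:
  fixes R :: "('r, 's) ring_scheme"
    and A :: "('r, 'a, 'm) module_scheme"
    and \<alpha> :: "('a \<times> 'a) set"
  assumes "cring R"
    and "end_frel_obj R (A, \<alpha>)"
  shows "szym_frel_isomorphic R (A, \<alpha>) (Leray_obj R (A, \<alpha>))"
proof -
  interpret A: finite_length_endorelation R A \<alpha>
    using assms(2) by (simp add: end_frel_obj_iff)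
  obtain B \<beta> where LM: "LM_obj R (A, \<alpha>) = (B, \<beta>)" by fastforce
  interpret B: finite_length_endorelation R B \<beta>
    using A.end_frel_obj_LM by (simp add: LM end_frel_obj_iff)
  have L: "Leray_obj R (A, \<alpha>) = LE_obj (B, \<beta>)" by (simp add: Leray_obj_def LM)
  note obj = assms(2) A.end_frel_obj_LM[unfolded LM] B.end_frel_obj_LE
  have "shift_equivalent R (A, \<alpha>) (LE_obj (B, \<beta>))"
    using shift_equivalent_trans[OF obj A.LM_shift_equivalent[unfolded LM] B.LE_shift_equivalent] .
  then show ?thesis
    unfolding L by (rule szym_frel_isomorphic_if_shift_equivalent[OF obj(1,3)])
qed

end
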